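(* Let $g,k$ be integers with $g\ge k+3\ge 6$. Then $H_1(\mathfrak{a}_g^+)_k=0$, i.e. $\mathfrak{a}_g(k)=\sum_{i+j=k,\ i,j\ge1}[\mathfrak{a}_g(i),\mathfrak{a}_g(j)]$.
   Context: $H_{\mathbb{Q}}$ is the $2g$-dimensional $\mathbb{Q}$-vector space with basis $a_1,\dots,a_g,b_1,\dots,b_g$, and $\omega_0=\sum_{i=1}^g(a_i\otimes b_i-b_i\otimes a_i)\in H_{\mathbb{Q}}^{\otimes2}$. $\mathfrak{a}_g$ is the Lie algebra over $\mathbb{Q}$ of all $\mathbb{Q}$-linear derivations $D$ of the tensor algebra without constant terms $T(H_{\mathbb{Q}})=\bigoplus_{i\ge1}H_{\mathbb{Q}}^{\otimes i}$ (that is, $D(X\otimes Y)=D(X)\otimes Y+X\otimes D(Y)$) which are symplectic, i.e. $D(\omega_0)=0$, with bracket $[F,G]=F\circ G-G\circ F$. It is graded, $\mathfrak{a}_g=\bigoplus_{k\ge0}\mathfrak{a}_g(k)$, where $\mathfrak{a}_g(k)$ consists of those $D$ with $D(H_{\mathbb{Q}})\subset H_{\mathbb{Q}}^{\otimes(k+1)}$; and $\mathfrak{a}_g^+=\bigoplus_{k\ge1}\mathfrak{a}_g(k)$. For subspaces $A,B$, $[A,B]$ is the span of all brackets. For $k\ge2$, the weight $k$ part $H_1(\mathfrak{a}_g^+)_k$ of the abelianization $\mathfrak{a}_g^+/[\mathfrak{a}_g^+,\mathfrak{a}_g^+]$ is the quotient of $\mathfrak{a}_g(k)$ by $\sum_{i+j=k,\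 i,j\ge1}[\mathfrak{a}_g(i),\mathfrak{a}_g(j)]$. *)

theory Defs
  imports
    Complex_Main
    "HOL-Library.Cardinality"
    "HOL-Library.Poly_Mapping"
    "HOL-Library.Function_Algebras"
    "HOL-Library.Set_Algebras"
begin

text \<open>
  The genus \<open>g\<close> is the cardinality of a finite index type \<open>'n\<close>: the symplectic basis of
  \<open>H\<close> is \<open>A i, B i\<close> with \<open>i :: 'n\<close>.
\<close>

datatype 'n letter = A 'n | B 'n

text \<open>
  Words under concatenation form a monoid, so that \<open>'n letter list \<Rightarrow>\<^sub>0 rat\<close> carries the
  convolution product of \<^theory>\<open>HOL-Library.Poly_Mapping\<close>; it is the unital tensor algebra, the
  word \<open>[x\<^sub>1, \<dots>, x\<^sub>m]\<close> standing for the basis tensor \<open>x\<^sub>1 \<otimes> \<dots> \<otimes> x\<^sub>m\<close>.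
\<close>

instantiation list :: (type) monoid_add
begin

definition zero_list :: "'a list" where "0 = []"

definition plus_list :: "'a list \<Rightarrow> 'a list \<Rightarrow> 'a list" where "u + v = u @ v"

instance
  by standard (auto simp: zero_list_def plus_list_def)

end

text \<open>
  The tensor algebra without constant terms: no term at the empty word. Its product \<open>*\<close>
  is the tensor product \<open>\<otimes>\<close>.
\<close>

typedef 'n tensor = "{p :: 'n letter list \<Rightarrow>\<^sub>0 rat. Poly_Mapping.lookup p [] = 0}"
  morphisms to_poly of_poly
  by (rule exI[of _ 0]) simp

setup_lifting type_definition_tensor

lemma lookup_times_Nil:
  fixes p q :: "'a list \<Rightarrow>\<^sub>0 rat"
  assumes "Poly_Mapping.lookup p [] = 0"
  shows "Poly_Mapping.lookup (p * q) [] = 0"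
proof -
  have "Poly_Mapping.lookup p l *
      Sum_any (\<lambda>r. Poly_Mapping.lookup q r when [] = l + r) = 0" for l
    using assms by (cases "l = []") (simp_all add: plus_list_def)
  then show ?thesis
    by (simp only: lookup_mult Sum_any.neutral)
qed

instantiation tensor :: (type) ring
begin

lift_definition zero_tensor :: "'a tensor" is 0 by simp

lift_definition plus_tensor :: "'a tensor \<Rightarrow> 'a tensor \<Rightarrow> 'a tensor" is "(+)"
  by (simp add: lookup_add)

lift_definition minus_tensor :: "'a tensor \<Rightarrow> 'a tensor \<Rightarrow> 'a tensor" is "(-)"
  by (simp add: lookup_minus)

lift_definition uminus_tensor :: "'a tensor \<Rightarrow> 'a tensor" is uminus
  by simp

lift_definition times_tensor :: "'a tensor \<Rightarrow> 'a tensor \<Rightarrow> 'a tensor" is "(*)"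
  by (rule lookup_times_Nil)

instance
proof
  fix x y z :: "'a tensor"
  show "x + y + z = x + (y + z)" by transfer (rule add.assoc)
  show "x + y = y + x" by transfer (rule add.commute)
  show "0 + x = x" by transfer (rule add_0)
  show "- x + x = 0" by transfer (rule left_minus)
  show "x - y = x + - y" by transfer (rule diff_conv_add_uminus)
  show "x * y * z = x * (y * z)" by transfer (rule mult.assoc)
  show "(x + y) * z = x * z + y * z" by transfer (rule distrib_right)
  show "x * (y + z) = x * y + x * z" by transfer (rule distrib_left)
qed

end

lift_definition tensor_scale :: "rat \<Rightarrow> 'n tensor \<Rightarrow> 'n tensor" is "\<lambda>c. Poly_Mapping.map ((*) c)"
  by (simp add: Poly_Mapping.map.rep_eq)

global_interpretation tensor: vector_space tensor_scale
proof
  fix c d :: rat and x y :: "'n tensor"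
  show "tensor_scale c (x + y) = tensor_scale c x + tensor_scale c y"
    by transfer (simp only: mult_map_scale_conv_mult distrib_left)
  show "tensor_scale (c + d) x = tensor_scale c x + tensor_scale d x"
    by transfer (simp only: mult_map_scale_conv_mult single_add distrib_right)
  show "tensor_scale c (tensor_scale d x) = tensor_scale (c * d) x"
    by transfer (simp only: mult_map_scale_conv_mult mult_single mult.assoc[symmetric] add_0)
  show "tensor_scale 1 x = x"
    by transfer (simp only: mult_map_scale_conv_mult single_one mult_1)
qed

lift_definition basis_a :: "'n \<Rightarrow> 'n tensor" is "\<lambda>i. Poly_Mapping.single [A i] 1"
  by (simp add: lookup_single)

lift_definition basis_b :: "'n \<Rightarrow> 'n tensor" is "\<lambda>i. Poly_Mapping.single [B i] 1"
  by (simp add: lookup_single)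

definition tensor_power :: "nat \<Rightarrow> 'n tensor set"
  where "tensor_power m = {x. \<forall>w \<in> Poly_Mapping.keys (to_poly x). length w = m}"

definition omega0 :: "'n::finite tensor"
  where "omega0 = (\<Sum>i\<in>UNIV. basis_a i * basis_b i - basis_b i * basis_a i)"

definition derivation :: "('n tensor \<Rightarrow> 'n tensor) \<Rightarrow> bool"
  where "derivation D \<longleftrightarrow>
    Vector_Spaces.linear tensor_scale tensor_scale D \<and> (\<forall>x y. D (x * y) = D x * y + x * D y)"

definition sympl_der :: "('n::finite tensor \<Rightarrow> 'n tensor) set"
  where "sympl_der = {D. derivation D \<and> D omega0 = 0}"

definition sympl_der_weight :: "nat \<Rightarrow> ('n::finite tensor \<Rightarrow> 'n tensor) set"
  where "sympl_der_weight k = {D \<in> sympl_der. D ` tensor_power 1 \<subseteq> tensor_power (k + 1)}"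

text \<open>The rational vector space of self-maps of the tensor algebra, with pointwise operations.\<close>

definition operator_scale :: "rat \<Rightarrow> ('n tensor \<Rightarrow> 'n tensor) \<Rightarrow> 'n tensor \<Rightarrow> 'n tensor"
  where "operator_scale c F = (\<lambda>x. tensor_scale c (F x))"

global_interpretation operator: vector_space operator_scale
proof
  fix c d :: rat and F G :: "'n tensor \<Rightarrow> 'n tensor"
  show "operator_scale c (F + G) = operator_scale c F + operator_scale c G"
    by (rule ext) (simp add: operator_scale_def tensor.scale_right_distrib)
  show "operator_scale (c + d) F = operator_scale c F + operator_scale d F"
    by (rule ext) (simp add: operator_scale_def tensor.scale_left_distrib)
  show "operator_scale c (operator_scale d F) = operator_scale (c * d) F"
    by (rule ext) (simp add: operator_scale_def)
  show "operator_scale 1 F = F"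
    by (rule ext) (simp add: operator_scale_def)
qed

definition bracket :: "('n tensor \<Rightarrow> 'n tensor) \<Rightarrow> ('n tensor \<Rightarrow> 'n tensor) \<Rightarrow> 'n tensor \<Rightarrow> 'n tensor"
  where "bracket F G = (F \<circ> G) - (G \<circ> F)"

definition brackets ::
    "('n tensor \<Rightarrow> 'n tensor) set \<Rightarrow> ('n tensor \<Rightarrow> 'n tensor) set \<Rightarrow> ('n tensor \<Rightarrow> 'n tensor) set"
  where "brackets U V = operator.span {bracket F G | F G. F \<in> U \<and> G \<in> V}"

text \<open>
  The sum is the sum of subspaces: \<open>+\<close> on sets is elementwise addition, with unit \<open>{0}\<close>
  (\<^theory>\<open>HOL-Library.Set_Algebras\<close>).
\<close>

definition decomposables :: "nat \<Rightarrow> ('n::finite tensor \<Rightarrow> 'n tensor) set"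
  where "decomposables k =
    (\<Sum>(i, j) \<in> {(i, j). i + j = k \<and> 1 \<le> i \<and> 1 \<le> j}.
      brackets (sympl_der_weight i) (sympl_der_weight j))"

text \<open>
  The weight \<open>k\<close> part of the abelianization of the Lie algebra of symplectic derivations of
  positive weight, as the set of cosets. Its zero element is the coset \<open>decomposables k\<close>.
\<close>

definition H1_weight :: "nat \<Rightarrow> ('n::finite tensor \<Rightarrow> 'n tensor) set set"
  where "H1_weight k = sympl_der_weight k //
    {(D, E). D \<in> sympl_der_weight k \<and> E \<in> sympl_der_weight k \<and> D - E \<in> decomposables k}"

end

theory Submission
  imports Defs "HOL-Library.Multiset"
begin

text \<open>
  A cyclic word \<open>w\<close> of length \<open>k + 2\<close> acts as a symplectic derivation of weight \<open>k\<close>, and these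
  derivations span; their bracket is the necklace bracket, which contracts a letter of one word
  with a dual letter of the other. The decomposables are stable under the derivations of weight
  \<open>0\<close>. As \<open>g > k + 2\<close>, there is always an unused index, and acting by a quadratic word that
  involves it reduces everything to words without repeated letters, i.e. to chord diagrams on a
  circle (a chord joins the two letters \<open>A i\<close> and \<open>B i\<close>) with some unmatched points, the legs.
  By induction on the number of chords the names of the chords do not matter, up to a sign for
  each reversal.

  Bracketing \<open>A i # u\<close> with \<open>B i # v\<close> for an unused \<open>i\<close> expresses the diagram \<open>u @ v\<close> through the
  diagrams obtained by contracting the chords between \<open>u\<close> and \<open>v\<close>. Cutting out an arc next to a
  chain of chords, each crossing only its neighbours, rewrites a diagram into diagrams with longer
  chains, so that finally one arc beside the chain is empty or a single leg. Such a diagram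
  vanishes: twins, i.e. crossing chords with adjacent ends, vanish at the end of a chain of odd
  length, which covers the chains of even length; a chain of odd length is compared with a shorter chain whose
  arcs enclose the ends of a further chord.
\<close>

section \<open>Letters and chord diagrams\<close>

fun dual :: "'n letter \<Rightarrow> 'n letter" where
  "dual (A i) = B i"
| "dual (B i) = A i"

lemma dual_dual [simp]: "dual (dual x) = x"
  by (cases x) auto

lemma dual_neq [simp]: "dual x \<noteq> x" "x \<noteq> dual x"
  by (cases x; simp)+

lemma dual_eq_iff [simp]: "dual x = dual y \<longleftrightarrow> x = y"
  by (metis dual_dual)

text \<open>Two chords trade places and one of them is reversed, hence the sign \<open>-1\<close> in the locale below.\<close>

definition exchange :: "'n letter \<Rightarrow> 'n letter \<Rightarrow> 'n letter \<Rightarrow> 'n letter" where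
  "exchange y p x =
    (if x = y then p else if x = dual y then dual p
     else if x = p then dual y else if x = dual p then y else x)"

lemma map_exchange_idle:
  "y \<notin> set w \<Longrightarrow> dual y \<notin> set w \<Longrightarrow> p \<notin> set w \<Longrightarrow> dual p \<notin> set w \<Longrightarrow> map (exchange y p) w = w"
  by (rule map_idI) (auto simp: exchange_def)

text \<open>
  One term of the necklace bracket of \<open>A i # u\<close> and \<open>B i # v\<close>: the chord from \<open>v ! k\<close> into \<open>u\<close> is
  contracted, and the new chord \<open>i\<close> inherits its name. The reversal built into this renaming
  absorbs all signs. The value is \<open>0\<close> if the dual of \<open>v ! k\<close> does not occur in \<open>u\<close>.
\<close>

definition resplice :: "('n letter list \<Rightarrow> rat) \<Rightarrow> 'n letter list \<Rightarrow> 'n letter list \<Rightarrow> nat \<Rightarrow> rat" where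
  "resplice f u v k = (\<Sum>q<length u. if u ! q = dual (v ! k)
     then f (drop (Suc q) u @ v ! k # take q u @ drop (Suc k) v @ dual (v ! k) # take k v) else 0)"

lemma resplice_single:
  assumes "dual (v ! k) \<notin> set u1" "dual (v ! k) \<notin> set u2"
    and "u = u1 @ dual (v ! k) # u2"
  shows "resplice f u v k = f (u2 @ v ! k # u1 @ drop (Suc k) v @ dual (v ! k) # take k v)"
proof -
  have *: "u ! q = dual (v ! k) \<longleftrightarrow> q = length u1" if "q < length u" for q
  proof -
    consider "q < length u1" | "q = length u1" | r where "q = length u1 + Suc r"
      by (metis add_Suc_right less_imp_Suc_add nat_neq_iff)
    then show ?thesis
    proof cases
      case 1
      then have "u ! q \<in> set u1" using assms(3) by (simp add: nth_append)
      then show ?thesis using assms(1) 1 by auto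
    next
      case 2
      then show ?thesis using assms by simp
    next
      case 3
      then have "r < length u2" using that assms by simp
      then have "u ! q \<in> set u2" using assms(3) 3 by (simp add: nth_append)
      then show ?thesis using assms(2) 3 by auto
    qed
  qed
  have "resplice f u v k = (\<Sum>q<length u. if q = length u1
     then f (drop (Suc q) u @ v ! k # take q u @ drop (Suc k) v @ dual (v ! k) # take k v) else 0)"
    unfolding resplice_def by (rule sum.cong) (auto simp: *)
  also have "\<dots> = f (u2 @ v ! k # u1 @ drop (Suc k) v @ dual (v ! k) # take k v)"
    using assms(3) by (simp add: sum.delta)
  finally show ?thesis .
qed

lemma resplice_none: "dual (v ! k) \<notin> set u \<Longrightarrow> resplice f u v k = 0"
  unfolding resplice_def by (rule sum.neutral) (auto simp: set_conv_nth)


text \<open>No letter of such a word is a leg or has its dual outside the word. The part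
  \<open>X @ Y\<close> of a diagram around its two arcs has this property, so that a cut can only
  contract chords joining the arcs.\<close>

definition dual_closed :: "'n letter list \<Rightarrow> bool" where
  "dual_closed w \<longleftrightarrow> dual ` set w \<subseteq> set w"

lemma dual_closed_extend: "dual_closed (X @ Y) \<Longrightarrow> dual_closed ((X @ p # Y) @ [dual p])"
  by (auto simp: dual_closed_def)

text \<open>
  In a diagram \<open>X @ a @ Y @ b\<close> with \<open>chain j X Y\<close>, the last chord of the chain separates the arcs
  \<open>a\<close> and \<open>b\<close>; the other \<open>j - 1\<close> chords are hidden in \<open>X\<close>.
\<close>

inductive chain :: "nat \<Rightarrow> 'n letter list \<Rightarrow> 'n letter list \<Rightarrow> bool" where
  base: "chain (Suc 0) [x] [dual x]"
| step: "chain j X Y \<Longrightarrow> chain (Suc j) (X @ p # Y) [dual p]"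

lemma chain_dual_closed: "chain j X Y \<Longrightarrow> dual_closed (X @ Y)"
  by (induction rule: chain.induct) (auto simp: dual_closed_def)

lemma chain_nonempty: "chain j X Y \<Longrightarrow> X \<noteq> [] \<and> Y \<noteq> []"
  by (induction rule: chain.induct) auto

text \<open>Axiomatizes a linear functional that kills the decomposables, evaluated on the
  arrangements of one set \<open>S\<close> of letters. The Lie algebra enters only through
  \<open>exchange\<close>, which comes from the action of weight 0, and \<open>cut\<close>, which
  comes from the necklace bracket; the rest is combinatorics of chord diagrams.\<close>

locale necklace_functional =
  fixes f :: "'n letter list \<Rightarrow> rat" and S :: "'n letter set"
  assumes finite_S: "finite S" and card_S: "5 \<le> card S"
    and rotation: "f (u @ v) = f (v @ u)"
    and exchange: "\<lbrakk>distinct w; set w = S; {y, dual y, p, dual p} \<subseteq> S; p \<noteq> y; p \<noteq> dual y\<rbrakk>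
      \<Longrightarrow> f (map (exchange y p) w) = - f w"
    and cut: "\<lbrakk>distinct (u @ v); set (u @ v) = S; 2 \<le> length u; 2 \<le> length v\<rbrakk>
      \<Longrightarrow> f (u @ v) = (\<Sum>k<length v. resplice f u v k)"
begin

text \<open>Phrased with multisets so that simplification alone shows that a rearrangement of an
  admissible word is admissible.\<close>

definition adm :: "'n letter list \<Rightarrow> bool" where
  "adm w \<longleftrightarrow> mset w = mset_set S"

lemma adm_iff: "adm w \<longleftrightarrow> distinct w \<and> set w = S"
proof
  assume w: "adm w"
  then have "set_mset (mset w) = S"
    using finite_S by (simp add: adm_def)
  then have "set w = S" by simp
  moreover have "mset_set (set w) = mset w"
    using w calculation by (simp add: adm_def)
  then have "distinct w"
    by (metis card_distinct finite_set size_mset size_mset_set)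
  ultimately show "distinct w \<and> set w = S" by simp
next
  assume "distinct w \<and> set w = S"
  then show "adm w"
    using mset_set_set[of w] by (simp add: adm_def)
qed

lemma adm_cong: "adm w \<Longrightarrow> mset w = mset w' \<Longrightarrow> adm w'"
  by (simp add: adm_def)

lemma adm_length: "adm w \<Longrightarrow> length w = card S"
  by (auto simp: adm_iff distinct_card)

text \<open>Otherwise closure would put \<open>a\<close> into \<open>u\<close> as well, and the
  letter would be repeated.\<close>

lemma adm_closed_outside:
  assumes "adm w" "mset w = mset u + mset v" "dual_closed u" "a \<in> set v"
  shows "dual a \<notin> set u"
proof
  assume "dual a \<in> set u"
  then have "a \<in> set u" using assms(3) by (force simp: dual_closed_def)
  moreover have "distinct (u @ v)"
    using assms(1,2) adm_cong[of w "u @ v"] by (simp add: adm_iff)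
  ultimately show False using assms(4) by auto
qed

lemma exchange_arcs:
  assumes "adm w" "{y, dual y, p, dual p} \<subseteq> set w" "p \<noteq> y" "p \<noteq> dual y"
    and "map (exchange y p) w = w'"
  shows "f w' = - f w"
  using exchange[of w y p] assms unfolding adm_iff by blast

section \<open>Cutting an arc out of a diagram\<close>

lemma arc_expand:
  assumes "adm (X @ a @ Y @ b)" "2 \<le> length a" "2 \<le> length (X @ Y @ b)"
  shows "f (X @ a @ Y @ b) = (\<Sum>k<length a. resplice f (Y @ b @ X) a k)"
proof -
  have "f (X @ a @ Y @ b) = f ((Y @ b @ X) @ a)"
    using rotation[of "X @ a" "Y @ b"] by simp
  also have "\<dots> = (\<Sum>k<length a. resplice f (Y @ b @ X) a k)"
    using assms adm_cong[OF assms(1), of "(Y @ b @ X) @ a"]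
    by (intro cut) (auto simp: adm_iff)
  finally show ?thesis .
qed

text \<open>With \<open>p = a ! k\<close> the result has the frame \<open>X @ p # Y\<close>,
  \<open>[dual p]\<close> and the arcs \<open>b1 @ drop (Suc k) a\<close> and
  \<open>take k a @ b2\<close>. The contracted chord has moved into the frame, as in
  \<open>chain.step\<close>, and the arcs have lost its two ends.\<close>

lemma resplice_arc:
  assumes "adm (X @ a @ Y @ b)" "dual_closed (X @ Y)" "k < length a" "b = b1 @ dual (a ! k) # b2"
  shows "resplice f (Y @ b @ X) a k
    = f (X @ a ! k # Y @ b1 @ drop (Suc k) a @ dual (a ! k) # take k a @ b2)"
proof -
  have "dual (a ! k) \<notin> set (X @ Y)"
    using assms by (intro adm_closed_outside[OF assms(1), of _ "a @ b"]) auto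
  moreover have "distinct b" using assms(1) by (simp add: adm_iff)
  ultimately have "resplice f (Y @ b @ X) a k
      = f ((b2 @ X) @ a ! k # (Y @ b1) @ drop (Suc k) a @ dual (a ! k) # take k a)"
    using assms(4) by (intro resplice_single) auto
  also have "\<dots> = f (X @ a ! k # Y @ b1 @ drop (Suc k) a @ dual (a ! k) # take k a @ b2)"
    using rotation[of b2 "X @ a ! k # (Y @ b1) @ drop (Suc k) a @ dual (a ! k) # take k a"] by simp
  finally show ?thesis .
qed

lemma resplice_arc_none:
  assumes "adm (X @ a @ Y @ b)" "dual_closed (X @ Y)" "k < length a" "dual (a ! k) \<notin> set b"
  shows "resplice f (Y @ b @ X) a k = 0"
proof -
  have "dual (a ! k) \<notin> set (X @ Y)"
    using assms by (intro adm_closed_outside[OF assms(1), of _ "a @ b"]) auto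
  then show ?thesis using assms(4) by (intro resplice_none) auto
qed

text \<open>The form in which cuts are iterated: only chords between the two arcs contribute, each
  with one diagram that has one more chord in the frame.\<close>

lemma arc_vanish:
  assumes "adm (X @ a @ Y @ b)" "dual_closed (X @ Y)" "2 \<le> length a" "2 \<le> length (X @ Y @ b)"
    and "\<And>a1 p a2 b1 b2. a = a1 @ p # a2 \<Longrightarrow> b = b1 @ dual p # b2
      \<Longrightarrow> f ((X @ p # Y) @ (b1 @ a2) @ [dual p] @ (a1 @ b2)) = 0"
  shows "f (X @ a @ Y @ b) = 0"
proof -
  have "resplice f (Y @ b @ X) a k = 0" if "k < length a" for k
  proof (cases "dual (a ! k) \<in> set b")
    case True
    then obtain b1 b2 where b: "b = b1 @ dual (a ! k) # b2" by (meson split_list)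
    show ?thesis
      using resplice_arc[OF assms(1,2) that b] assms(5)[OF id_take_nth_drop[OF that] b] by simp
  next
    case False
    then show ?thesis using resplice_arc_none assms(1,2) that by blast
  qed
  then show ?thesis using arc_expand[OF assms(1,3,4)] by simp
qed

lemma arc_vanish_uncrossed:
  assumes "adm (X @ a @ Y @ b)" "dual_closed (X @ Y)" "2 \<le> length a" "2 \<le> length (X @ Y @ b)"
    and "\<And>p. p \<in> set a \<Longrightarrow> dual p \<notin> set b"
  shows "f (X @ a @ Y @ b) = 0"
proof (rule arc_vanish[OF assms(1-4)])
  fix a1 p a2 b1 b2 assume "a = a1 @ p # a2" "b = b1 @ dual p # b2"
  then show "f ((X @ p # Y) @ (b1 @ a2) @ [dual p] @ (a1 @ b2)) = 0"
    using assms(5)[of p] by simp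
qed

section \<open>Arcs of two letters, enclosing chords and longer chains\<close>

lemma arc2_expand:
  assumes adm: "adm (X @ [y, z] @ Y @ b)" and "dual_closed (X @ Y)" "X \<noteq> []" "Y \<noteq> []"
  shows "f (X @ [y, z] @ Y @ b) =
    resplice f (Y @ b @ X) [y, z] 0 + resplice f (Y @ b @ X) [y, z] 1"
  using assms
proof -
  have "2 \<le> length (X @ Y @ b)" using assms(3,4) by (cases X; cases Y) auto
  then show ?thesis using arc_expand[OF adm] by (simp add: numeral_2_eq_2)
qed

lemma arc2_cross_cross:
  assumes adm: "adm (X @ [y, z] @ Y @ b)" and "dual_closed (X @ Y)" "X \<noteq> []" "Y \<noteq> []"
    and "b = b1 @ dual y # b2" "b = c1 @ dual z # c2"
  shows "f (X @ [y, z] @ Y @ b) =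
    f (X @ y # Y @ b1 @ z # dual y # b2) + f (X @ z # Y @ c1 @ dual z # y # c2)"
proof -
  have "resplice f (Y @ b @ X) [y, z] 0 = f (X @ y # Y @ b1 @ z # dual y # b2)"
    using resplice_arc[OF assms(1,2), of 0 b1 b2] assms(5) by simp
  moreover have "resplice f (Y @ b @ X) [y, z] 1 = f (X @ z # Y @ c1 @ dual z # y # c2)"
    using resplice_arc[OF assms(1,2), of 1 c1 c2] assms(6) by simp
  ultimately show ?thesis using arc2_expand[OF assms(1-4)] by simp
qed

lemma arc2_cross_leg:
  assumes adm: "adm (X @ [y, z] @ Y @ b)" and "dual_closed (X @ Y)" "X \<noteq> []" "Y \<noteq> []"
    and "b = b1 @ dual y # b2" "dual z \<notin> set b"
  shows "f (X @ [y, z] @ Y @ b) = f (X @ y # Y @ b1 @ z # dual y # b2)"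
  using arc2_expand[OF assms(1-4)] resplice_arc[OF assms(1,2), of 0 b1 b2]
    resplice_arc_none[OF assms(1,2), of 1] assms(5,6) by simp

text \<open>The ends of the chord \<open>x\<close> lie on the two sides of \<open>X\<close>.
  Contracting it leaves an empty arc, so this term vanishes by \<open>arc_vanish_uncrossed\<close>.
  There remain the term of \<open>z\<close>, written out, and those of \<open>c\<close>.\<close>

lemma arc_expand_enclosed:
  assumes adm: "adm (X @ (dual x # z # c) @ Y @ (dual z # b @ [x]))"
    and XY: "dual_closed (X @ Y)" "X \<noteq> []" "Y \<noteq> []"
  shows "f (X @ (dual x # z # c) @ Y @ (dual z # b @ [x])) =
    f (X @ z # Y @ c @ dual z # dual x # b @ [x])
    + (\<Sum>k<length c. resplice f (Y @ (dual z # b @ [x]) @ X) (dual x # z # c) (Suc (Suc k)))"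
proof -
  let ?a = "dual x # z # c" and ?b = "dual z # b @ [x]"
  have "f (X @ ?a @ Y @ ?b) = (\<Sum>k<length ?a. resplice f (Y @ ?b @ X) ?a k)"
    using adm by (rule arc_expand) auto
  also have "\<dots> = resplice f (Y @ ?b @ X) ?a 0 + resplice f (Y @ ?b @ X) ?a 1
      + (\<Sum>k<length c. resplice f (Y @ ?b @ X) ?a (Suc (Suc k)))"
    by (simp del: sum.lessThan_Suc add: sum.lessThan_Suc_shift)
  also have "resplice f (Y @ ?b @ X) ?a 0 = 0"
  proof -
    have "resplice f (Y @ ?b @ X) ?a 0
        = f ((X @ dual x # Y) @ (dual z # b @ z # c) @ [x] @ [])"
      using resplice_arc[OF adm XY(1), of 0 "dual z # b" "[]"] by simp
    also have "\<dots> = 0"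
      using XY dual_closed_extend[OF XY(1), of "dual x"]
      by (intro arc_vanish_uncrossed) (simp_all add: adm_cong[OF adm])
    finally show ?thesis .
  qed
  also have "resplice f (Y @ ?b @ X) ?a 1 = f (X @ z # Y @ c @ dual z # dual x # b @ [x])"
    using resplice_arc[OF adm XY(1), of 1 "[]" "b @ [x]"] by simp
  finally show ?thesis by simp
qed

text \<open>
  Both sides of the cut produce the diagram \<open>X @ z # Y @ q # \<dots>\<close>, with \<open>z\<close> and \<open>q\<close> exchanged, so these
  two terms cancel. Thus relations for a chain carry over to the chain with two more chords.
\<close>

lemma chain_transfer:
  assumes adm: "adm (X @ [z, q] @ Y @ (dual z # r # dual q # c @ dual r # d))"
    and XY: "dual_closed (X @ Y)" "X \<noteq> []" "Y \<noteq> []"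
  shows "f (X @ [z, q] @ Y @ (dual z # r # dual q # c @ dual r # d))
    = f ((X @ q # Y) @ r # dual q # z # c @ dual r # dual z # d)"
proof -
  let ?t = "X @ z # Y @ q # dual z # r # dual q # c @ dual r # d"
  let ?X = "X @ q # Y"
  have "f (X @ [z, q] @ Y @ (dual z # r # dual q # c @ dual r # d)) = f ?t
      + f (?X @ [dual z, r] @ [dual q] @ (z # c @ dual r # d))"
    using arc2_cross_cross[OF adm XY, of "[]" _ "[dual z, r]"] by simp
  also have "f (?X @ [dual z, r] @ [dual q] @ (z # c @ dual r # d))
      = f (?X @ dual z # dual q # r # z # c @ dual r # d)
      + f (?X @ r # dual q # z # c @ dual r # dual z # d)"
    using arc2_cross_cross[of ?X "dual z" r "[dual q]" _ "[]" "c @ dual r # d" "z # c" d, OF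
      adm_cong[OF adm] dual_closed_extend[OF XY(1)]] by simp
  also have "f (?X @ dual z # dual q # r # z # c @ dual r # d) = - f ?t"
  proof (rule exchange_arcs)
    show t: "adm ?t" using adm by (rule adm_cong) simp
    then have "distinct ?t" by (simp add: adm_iff)
    then show "map (exchange z q) ?t = ?X @ dual z # dual q # r # z # c @ dual r # d" "q \<noteq> z" "q \<noteq> dual z"
      by (auto simp: map_exchange_idle exchange_def)
  qed auto
  finally show ?thesis by simp
qed

text \<open>The cancellation of \<open>chain_transfer\<close> in the presence of a chord
  \<open>x\<close> around \<open>X\<close>. On the right \<open>x\<close> encloses
  \<open>X @ q # Y @ [r, dual q]\<close>, so the shape is the same for a chain with two more chords
  and the relation can be iterated.\<close>

lemma chain_transfer_enclosed:
  assumes adm: "adm (X @ (dual x # z # [q]) @ Y @ (dual z # (r # dual q # c @ dual r # d) @ [x]))"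
    and XY: "dual_closed (X @ Y)" "X \<noteq> []" "Y \<noteq> []"
  shows "f (X @ (dual x # z # [q]) @ Y @ (dual z # (r # dual q # c @ dual r # d) @ [x]))
    = f ((X @ q # Y) @ r # dual q # dual x # z # c @ dual r # dual z # d @ [x])"
proof -
  let ?b = "r # dual q # c @ dual r # d"
  let ?t = "X @ z # Y @ q # dual z # dual x # r # dual q # c @ dual r # d @ [x]"
  let ?X = "X @ q # Y"
  have "f (X @ (dual x # z # [q]) @ Y @ (dual z # ?b @ [x])) = f ?t
      + resplice f (Y @ (dual z # ?b @ [x]) @ X) (dual x # z # [q]) 2"
    using arc_expand_enclosed[OF adm XY] by (simp add: numeral_2_eq_2)
  also have "resplice f (Y @ (dual z # ?b @ [x]) @ X) (dual x # z # [q]) 2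
      = f (?X @ [dual z, r] @ [dual q] @ (dual x # z # c @ dual r # d @ [x]))"
    using resplice_arc[OF adm XY(1), of 2 "[dual z, r]" "c @ dual r # d @ [x]"] by simp
  also have "f (?X @ [dual z, r] @ [dual q] @ (dual x # z # c @ dual r # d @ [x]))
      = f (?X @ dual z # dual q # dual x # r # z # c @ dual r # d @ [x])
      + f (?X @ r # dual q # dual x # z # c @ dual r # dual z # d @ [x])"
    using arc2_cross_cross[of ?X "dual z" r "[dual q]" _ "[dual x]" "c @ dual r # d @ [x]"
      "dual x # z # c" "d @ [x]", OF adm_cong[OF adm] dual_closed_extend[OF XY(1)]] by simp
  also have "f (?X @ dual z # dual q # dual x # r # z # c @ dual r # d @ [x]) = - f ?t"
  proof (rule exchange_arcs)
    show t: "adm ?t" using adm by (rule adm_cong) simp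
    then have "distinct ?t" by (simp add: adm_iff)
    then show "map (exchange z q) ?t = ?X @ dual z # dual q # dual x # r # z # c @ dual r # d @ [x]"
      "q \<noteq> z" "q \<noteq> dual z"
      by (auto simp: map_exchange_idle exchange_def)
  qed auto
  finally show ?thesis by simp
qed

text \<open>Cutting out the pair \<open>x\<close>, \<open>y\<close> gives one term for each of the
  two chords, and exchanging \<open>x\<close> and \<open>y\<close> turns one term into the other
  with sign \<open>-1\<close>.\<close>

lemma twin_vanish_base:
  assumes adm: "adm (x # y # c @ dual x # dual y # d)"
  shows "f (x # y # c @ dual x # dual y # d) = 0"
proof -
  let ?u = "c @ dual x # dual y # d"
  let ?s = "x # c @ y # dual x # dual y # d" and ?t = "y # c @ dual x # dual y # x # d"
  have "distinct (?u @ [x, y])"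
    using adm adm_cong[OF adm, of "?u @ [x, y]"] by (simp add: adm_iff)
  then have disj: "dual x \<notin> set c" "dual x \<notin> set (dual y # d)" "dual y \<notin> set (c @ [dual x])"
    "dual y \<notin> set d" by auto
  have "f (x # y # ?u) = f (?u @ [x, y])"
    using rotation[of "[x, y]" ?u] by simp
  also have "\<dots> = resplice f ?u [x, y] 0 + resplice f ?u [x, y] 1"
  proof -
    have "f (?u @ [x, y]) = (\<Sum>k<length [x, y]. resplice f ?u [x, y] k)"
      using adm adm_cong[OF adm, of "?u @ [x, y]"] by (intro cut) (auto simp: adm_iff)
    then show ?thesis by (simp add: numeral_2_eq_2)
  qed
  also have "resplice f ?u [x, y] 0 = f ((dual y # d) @ x # c @ y # [dual x])"
    using disj resplice_single[of "[x, y]" 0 c "dual y # d" ?u] by simp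
  also have "\<dots> = f ?s"
    using rotation[of "dual y # d" "x # c @ y # [dual x]"] by simp
  also have "resplice f ?u [x, y] 1 = f (d @ y # c @ dual x # dual y # [x])"
    using disj resplice_single[of "[x, y]" 1 "c @ [dual x]" d ?u] by simp
  also have "\<dots> = f ?t"
    using rotation[of d "y # c @ dual x # dual y # [x]"] by simp
  also have "f ?t = - f ?s"
  proof (rule exchange_arcs)
    show t: "adm ?s" using adm by (rule adm_cong) simp
    then have "distinct ?s" by (simp add: adm_iff)
    then show "map (exchange x y) ?s = ?t" "y \<noteq> x" "y \<noteq> dual x"
      by (auto simp: map_exchange_idle exchange_def)
  qed auto
  finally show ?thesis by simp
qed

text \<open>For \<open>j = 1\<close> the chord \<open>y\<close> is a twin of the only chord of the
  chain. In the step, \<open>chain_transfer\<close> identifies the diagram with one over a chain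
  with two chords less, where the last chord but one, \<open>p\<close>, has an end next to
  \<open>y\<close> in the arc \<open>[y, p]\<close>.\<close>

lemma twin_vanish:
  assumes "chain j X Y" "odd j" "adm (X @ (y # c) @ Y @ (dual y # d))"
  shows "f (X @ (y # c) @ Y @ (dual y # d)) = 0"
  using assms
proof (induction j arbitrary: X Y y c d rule: less_induct)
  case (less j)
  from less.prems(1) show ?case
  proof cases
    case (base x)
    then show ?thesis using twin_vanish_base[of x y c d] less.prems(3) by simp
  next
    case (step j1 X1 Y1 q)
    from step(4) show ?thesis
    proof cases
      case base
      then show ?thesis using less.prems(2) step by simp
    next
      case inner: (step j2 X0 Y0 p)
      have adm: "adm (X0 @ [y, p] @ Y0 @ (dual y # q # dual p # c @ dual q # d))"
        using step inner by (intro adm_cong[OF less.prems(3)]) simp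
      then have "f (X0 @ [y, p] @ Y0 @ (dual y # q # dual p # c @ dual q # d)) = 0"
        using less.IH[of j2 X0 Y0 y "[p]" "q # dual p # c @ dual q # d"] inner step less.prems(2) by simp
      then show ?thesis
        using chain_transfer[OF adm chain_dual_closed] inner(4) chain_nonempty[OF inner(4)] step inner
        by simp
    qed
  qed
qed

text \<open>For a chain of three chords the two diagrams are rotations of each other if
  \<open>c\<close> is empty, and are related by a cut if \<open>c\<close> is a single letter. Longer
  chains follow by \<open>chain_transfer_enclosed\<close>, two chords at a time. The quantifiers
  over \<open>c\<close> and \<open>d\<close> stand inside the existential because the induction
  hypothesis is applied to the arc \<open>[q]\<close> of a shorter chain.\<close>

lemma enclosed_arc:
  assumes "chain j X Y" "odd j" "3 \<le> j"
  shows "\<exists>X' Y' x z. chain (j - 2) X' Y' \<and>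
    mset (X @ Y) = mset (X' @ Y') + mset [x, dual x, z, dual z] \<and>
    (\<forall>c d. length c \<le> 1 \<longrightarrow> adm (X @ c @ Y @ d) \<longrightarrow>
      f (X @ c @ Y @ d) = f (X' @ (dual x # z # c) @ Y' @ (dual z # d @ [x])))"
  using assms
proof (induction j arbitrary: X Y rule: less_induct)
  case (less j)
  from less.prems(1) show ?case
  proof cases
    case (base x)
    then show ?thesis using less.prems by simp
  next
    case (step j1 X1 Y1 r)
    from step(4) show ?thesis
    proof cases
      case base
      then show ?thesis using less.prems step by simp
    next
      case inner: (step j2 X0 Y0 q)
      show ?thesis
      proof (cases "j = 3")
        case True
        then have "chain (Suc 0) X0 Y0" using inner step by simp
        then obtain x where X0: "X0 = [x]" "Y0 = [dual x]"
          by cases (auto elim: chain.cases)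
        have X: "X = [x, q, dual x, r, dual q]" "Y = [dual r]"
          using X0 inner step by simp_all
        have chain2: "chain (Suc (Suc 0)) [x, q, dual x] [dual q]"
          using chain.step[OF chain.base, of x q] by simp
        have "f (X @ c @ Y @ d) = f ([q] @ (dual x # r # c) @ [dual q] @ (dual r # d @ [x]))"
          if c: "length c \<le> 1" and adm: "adm (X @ c @ Y @ d)" for c d
        proof -
          have "f ([q] @ (dual x # r # c) @ [dual q] @ (dual r # d @ [x]))
              = f ([x, q, dual x] @ (r # c) @ [dual q] @ (dual r # d))"
            using rotation[of "[q] @ (dual x # r # c) @ [dual q] @ (dual r # d)" "[x]"] by simp
          also have "\<dots> = f (X @ c @ Y @ d)"
          proof (cases c)
            case Nil
            then show ?thesis by (simp add: X)
          next
            case (Cons p c')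
            then have p: "c = [p]" using c by simp
            have adm2: "adm ([x, q, dual x] @ [r, p] @ [dual q] @ (dual r # d))"
              using adm by (rule adm_cong) (simp add: X p)
            note closed = chain_dual_closed[OF chain2]
            have rp: "dual p \<noteq> dual r" using adm2 by (auto simp: adm_iff)
            show ?thesis
            proof (cases "dual p \<in> set d")
              case False
              then show ?thesis
                using arc2_cross_leg[OF adm2 closed, of "[]" d] rp by (simp add: X p)
            next
              case True
              then obtain d1 d2 where d: "d = d1 @ dual p # d2" by (meson split_list)
              \<comment> \<open>The term that contracts \<open>p\<close>: here \<open>r\<close> lies
                at the end of the chain \<open>x\<close>, \<open>q\<close>, \<open>p\<close> of odd
                length, in the position required by \<open>twin_vanish\<close>.\<close>
              have "f (([x, q, dual x] @ p # [dual q]) @ (dual r # d1) @ [dual p] @ (dual (dual r) # d2)) = 0"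
                using chain.step[OF chain2, of p]
                by (intro twin_vanish) (auto simp: d intro!: adm_cong[OF adm2])
              then show ?thesis
                using arc2_cross_cross[OF adm2 closed, of "[]" d "dual r # d1" d2] by (simp add: X p d)
            qed
          qed
          finally show ?thesis by simp
        qed
        moreover have "chain (j - 2) [q] [dual q]"
          using True chain.base[of q] by simp
        moreover have "mset (X @ Y) = mset ([q] @ [dual q]) + mset [x, dual x, r, dual r]"
          by (simp add: X)
        ultimately show ?thesis by blast
      next
        case False
        have j: "j = Suc (Suc j2)" using inner step by simp
        then have "odd j2" using less.prems(2) by simp
        moreover have "2 \<le> j2" using j False less.prems(3) by simp
        ultimately have j2: "j2 < j" "odd j2" "3 \<le> j2" "j - 2 = Suc (Suc (j2 - 2))"
          using j by (cases "j2 = 2"; simp)+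
        obtain X' Y' x z where XY': "chain (j2 - 2) X' Y'"
          "mset (X0 @ Y0) = mset (X' @ Y') + mset [x, dual x, z, dual z]"
          and f: "\<And>c d. length c \<le> 1 \<Longrightarrow> adm (X0 @ c @ Y0 @ d) \<Longrightarrow>
            f (X0 @ c @ Y0 @ d) = f (X' @ (dual x # z # c) @ Y' @ (dual z # d @ [x]))"
          using less.IH[OF j2(1) inner(4) j2(2,3)] by blast
        let ?X = "(X' @ q # Y') @ r # [dual q]"
        have "f (X @ c @ Y @ d) = f (?X @ (dual x # z # c) @ [dual r] @ (dual z # d @ [x]))"
          if adm: "adm (X @ c @ Y @ d)" for c d
        proof -
          have adm': "adm (X' @ (dual x # z # [q]) @ Y' @ (dual z # (r # dual q # c @ dual r # d) @ [x]))"
            using XY'(2) step inner by (intro adm_cong[OF adm]) (simp add: ac_simps)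
          have "f (X @ c @ Y @ d) = f (X0 @ [q] @ Y0 @ (r # dual q # c @ dual r # d))"
            using step inner by simp
          also have "\<dots> = f (X' @ (dual x # z # [q]) @ Y' @ (dual z # (r # dual q # c @ dual r # d) @ [x]))"
            using step inner by (intro f adm_cong[OF adm]) simp_all
          also have "\<dots> = f (?X @ (dual x # z # c) @ [dual r] @ (dual z # d @ [x]))"
            using chain_transfer_enclosed[OF adm' chain_dual_closed[OF XY'(1)]] chain_nonempty[OF XY'(1)]
            by simp
          finally show ?thesis .
        qed
        moreover have "chain (j - 2) ?X [dual r]"
          using chain.step[OF chain.step[OF XY'(1), of q], of r] j2(4) by simp
        moreover have "mset (X @ Y) = mset (?X @ [dual r]) + mset [x, dual x, z, dual z]"
          using XY'(2) step inner by (simp add: ac_simps)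
        ultimately show ?thesis by blast
      qed
    qed
  qed
qed

text \<open>Without its last chord \<open>y\<close> the chain has odd length, and
  \<open>twin_vanish\<close> applies to \<open>y\<close>. If \<open>c\<close> is a leg
  \<open>p\<close>, cutting out the arc \<open>[y, p]\<close> of that vanishing diagram produces the
  given one as its only term.\<close>

lemma short_arc_vanish_even:
  assumes "chain j X Y" "even j" "adm (X @ c @ Y @ d)" "length c \<le> 1" "\<And>p. p \<in> set c \<Longrightarrow> dual p \<notin> S"
  shows "f (X @ c @ Y @ d) = 0"
  using assms(1)
proof cases
  case base
  then show ?thesis using assms(2) by simp
next
  case (step j0 X0 Y0 y)
  have adm: "adm (X0 @ (y # c) @ Y0 @ (dual y # d))"
    using step by (intro adm_cong[OF assms(3)]) simp
  have twin: "f (X0 @ (y # c) @ Y0 @ (dual y # d)) = 0"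
    using twin_vanish[OF step(4) _ adm] assms(2) step by simp
  show ?thesis
  proof (cases c)
    case Nil
    then show ?thesis using twin step by simp
  next
    case (Cons p c')
    then have c: "c = [p]" using assms(4) by simp
    have "dual p \<notin> set (dual y # d)" using adm assms(5)[of p] c unfolding adm_iff by auto
    then show ?thesis
      using arc2_cross_leg[of X0 y p Y0 "dual y # d" "[]" d] adm chain_dual_closed[OF step(4)]
        chain_nonempty[OF step(4)] twin step c by simp
  qed
qed

text \<open>For odd \<open>j\<close>, \<open>enclosed_arc\<close> shortens the chain by two chords,
  and the cut lengthens it again by \<open>z\<close>, which leads to the even case. The terms of
  \<open>c\<close> vanish because \<open>c\<close> contains only legs.\<close>

lemma short_arc_vanish:
  assumes "chain j X Y" "2 \<le> j" "adm (X @ c @ Y @ d)" "length c \<le> 1" "\<And>p. p \<in> set c \<Longrightarrow> dual p \<notin> S"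
  shows "f (X @ c @ Y @ d) = 0"
proof (cases "even j")
  case True
  then show ?thesis using short_arc_vanish_even assms by blast
next
  case False
  then have "3 \<le> j" using assms(2) by (cases "j = 2") auto
  from enclosed_arc[OF assms(1) False this]
  obtain X' Y' x z where XY': "chain (j - 2) X' Y'"
    "mset (X @ Y) = mset (X' @ Y') + mset [x, dual x, z, dual z]"
    and f: "f (X @ c @ Y @ d) = f (X' @ (dual x # z # c) @ Y' @ (dual z # d @ [x]))"
    using assms(3,4) by blast
  let ?w = "X' @ (dual x # z # c) @ Y' @ (dual z # d @ [x])"
  have adm: "adm ?w"
    using XY'(2) by (intro adm_cong[OF assms(3)]) (simp add: ac_simps)
  note closed = chain_dual_closed[OF XY'(1)]
  have "f ?w = f (X' @ z # Y' @ c @ dual z # dual x # d @ [x])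
    + (\<Sum>k<length c. resplice f (Y' @ (dual z # d @ [x]) @ X') (dual x # z # c) (Suc (Suc k)))"
    using chain_nonempty[OF XY'(1)] by (intro arc_expand_enclosed adm closed) auto
  also have "(\<Sum>k<length c. resplice f (Y' @ (dual z # d @ [x]) @ X') (dual x # z # c) (Suc (Suc k))) = 0"
  proof (intro sum.neutral ballI resplice_arc_none[OF adm closed])
    fix k assume k: "k \<in> {..<length c}"
    then have "dual (c ! k) \<notin> S" using assms(5) by simp
    then show "dual ((dual x # z # c) ! Suc (Suc k)) \<notin> set (dual z # d @ [x])"
      using adm unfolding adm_iff by auto
  qed auto
  also have "f (X' @ z # Y' @ c @ dual z # dual x # d @ [x]) = 0"
  proof -
    have "chain (Suc (j - 2)) (X' @ z # Y') [dual z]" using XY'(1) by (rule chain.step)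
    then have "f ((X' @ z # Y') @ c @ [dual z] @ (dual x # d @ [x])) = 0"
      using False assms(2,4,5)
      by (intro short_arc_vanish_even adm_cong[OF adm]) auto
    then show ?thesis by simp
  qed
  finally show ?thesis using f by simp
qed

text \<open>Each contraction moves the ends of a chord from the arcs into the frame and makes the
  chain longer; the arcs shrink until \<open>a\<close> is empty or a leg.\<close>

lemma chain_vanish:
  assumes "chain j X Y" "2 \<le> j" "adm (X @ a @ Y @ b)"
  shows "f (X @ a @ Y @ b) = 0"
  using assms
proof (induction "length a + length b" arbitrary: j X Y a b rule: less_induct)
  case less
  note XY = chain_dual_closed[OF less.prems(1)] chain_nonempty[OF less.prems(1)]
  have extend: "f ((X @ p # Y) @ (b1 @ a2) @ [dual p] @ (a1 @ b2)) = 0"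
    if "a = a1 @ p # a2" "b = b1 @ dual p # b2" for p a1 a2 b1 b2
    using less.prems that
    by (intro less.hyps[of _ _ "Suc j"] chain.step adm_cong[OF less.prems(3)]) auto
  consider "2 \<le> length a" | p where "a = [p]" "dual p \<in> S" | "length a \<le> 1" "\<And>p. p \<in> set a \<Longrightarrow> dual p \<notin> S"
    by (cases a rule: list.exhaust[case_product list.exhaust[of "tl a"]]) (auto simp: Suc_le_eq)
  then show ?case
  proof cases
    case 1
    have "2 \<le> length (X @ Y @ b)" using XY(2) by (cases X; cases Y) auto
    then show ?thesis using arc_vanish[OF less.prems(3) XY(1) 1] extend by blast
  next
    \<comment> \<open>A single chord end \<open>p\<close> needs no cut: counted as part of the
      frame, its chord already prolongs the chain.\<close>
    case 2
    have "dual p \<notin> set (X @ Y)"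
      using 2 by (intro adm_closed_outside[OF less.prems(3) _ XY(1), of "a @ b"]) auto
    then have "dual p \<in> set b"
      using 2 less.prems(3) unfolding adm_iff by auto
    then obtain b1 b2 where b: "b = b1 @ dual p # b2" by (meson split_list)
    then show ?thesis using extend[of "[]" p "[]" b1 b2] 2 by simp
  next
    case 3
    then show ?thesis using short_arc_vanish less.prems by blast
  qed
qed

text \<open>A diagram without chords vanishes since its cut has no terms. Otherwise any chord is a
  chain of length one, and one cut leads to chains of length two.\<close>

theorem vanish:
  assumes adm: "adm w"
  shows "f w = 0"
proof (cases "\<exists>x\<in>S. dual x \<in> S")
  case False
  define u v where "u = take 2 w" "v = drop 2 w"
  have w: "w = u @ v" "2 \<le> length u" "2 \<le> length v"
    using adm_length[OF adm] card_S by (auto simp: u_v_def)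
  have "f (u @ v) = (\<Sum>k<length v. resplice f u v k)"
    using adm w by (intro cut) (auto simp: adm_iff)
  also have "\<dots> = 0"
  proof (intro sum.neutral ballI resplice_none)
    fix k assume "k \<in> {..<length v}"
    then have "v ! k \<in> S" using adm w by (auto simp: adm_iff)
    then have "dual (v ! k) \<notin> S" using False by blast
    then show "dual (v ! k) \<notin> set u" using adm w by (auto simp: adm_iff)
  qed
  finally show ?thesis using w by simp
next
  case True
  then obtain x where x: "x \<in> S" "dual x \<in> S" by blast
  then obtain w1 w2 where w1: "w = w1 @ x # w2"
    using adm by (metis adm_iff split_list)
  have "dual x \<in> set (w2 @ w1)"
    using x adm w1 unfolding adm_iff by auto
  then obtain a b where ab: "w2 @ w1 = a @ dual x # b" by (meson split_list)
  have fw: "f w = f ([x] @ a @ [dual x] @ b)"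
    using rotation[of w1 "x # w2"] ab w1 by simp
  have adm': "adm ([x] @ a @ [dual x] @ b)"
    using adm ab[symmetric] w1 by (intro adm_cong[OF adm]) simp
  have extend: "f (([x] @ p # [dual x]) @ (b1 @ a2) @ [dual p] @ (a1 @ b2)) = 0"
    if "a = a1 @ p # a2" "b = b1 @ dual p # b2" for p a1 a2 b1 b2
    using that chain.step[OF chain.base, of x p]
    by (intro chain_vanish[of "Suc (Suc 0)"] adm_cong[OF adm']) auto
  have closed: "dual_closed ([x] @ [dual x])" by (simp add: dual_closed_def)
  consider "2 \<le> length a" | p where "a = [p]" "dual p \<in> S" | "length a \<le> 1" "\<And>p. p \<in> set a \<Longrightarrow> dual p \<notin> S"
    by (cases a rule: list.exhaust[case_product list.exhaust[of "tl a"]]) (auto simp: Suc_le_eq)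
  then show ?thesis
  proof cases
    case 1
    then show ?thesis using arc_vanish[OF adm' closed 1] extend fw by auto
  next
    case 2
    have "dual p \<in> set b"
      using 2 adm' unfolding adm_iff by auto
    then obtain b1 b2 where b: "b = b1 @ dual p # b2" by (meson split_list)
    then show ?thesis using extend[of "[]" p "[]" b1 b2] 2 fw by simp
  next
    case 3
    \<comment> \<open>No chord crosses \<open>x\<close>, so cutting out the other arc yields no
      terms. That arc has at least two letters because \<open>S\<close> has at least five.\<close>
    have "f ([dual x] @ b @ [x] @ a) = 0"
    proof (rule arc_vanish_uncrossed)
      show "adm ([dual x] @ b @ [x] @ a)" by (rule adm_cong[OF adm']) simp
      show "dual_closed ([dual x] @ [x])" by (simp add: dual_closed_def)
      show "2 \<le> length b" using adm_length[OF adm'] card_S 3(1) by simp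
      show "dual p \<notin> set a" if "p \<in> set b" for p
      proof
        assume "dual p \<in> set a"
        then have "p \<notin> S" using 3(2)[of "dual p"] by simp
        then show False using adm' that by (auto simp: adm_iff)
      qed
    qed simp
    then show ?thesis using rotation[of "[dual x] @ b" "[x] @ a"] fw by simp
  qed
qed

end

section \<open>Cyclic words as derivations\<close>

lift_definition coeff :: "'n tensor \<Rightarrow> 'n letter list \<Rightarrow> rat" is Poly_Mapping.lookup .

text \<open>The value \<open>0\<close> at the empty word is a default, as the algebra has no
  constant terms.\<close>

lift_definition word :: "'n letter list \<Rightarrow> 'n tensor"
  is "\<lambda>w. if w = [] then 0 else Poly_Mapping.single w 1"
  by (simp add: lookup_single)

lemma tensor_eqI: "(\<And>w. coeff x w = coeff y w) \<Longrightarrow> x = y"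
  by transfer (rule poly_mapping_eqI)

lemma coeff_Nil [simp]: "coeff x [] = 0"
  by transfer

lemma coeff_zero [simp]: "coeff 0 w = 0"
  by transfer simp

lemma coeff_add [simp]: "coeff (x + y) w = coeff x w + coeff y w"
  by transfer (simp add: lookup_add)

lemma coeff_scale [simp]: "coeff (tensor_scale c x) w = c * coeff x w"
  by transfer (simp add: Poly_Mapping.map.rep_eq when_def)

lemma coeff_sum: "coeff (sum x I) w = (\<Sum>i\<in>I. coeff (x i) w)"
  by (induction I rule: infinite_finite_induct) auto

lemma coeff_word: "coeff (word w) v = (if v = w \<and> w \<noteq> [] then 1 else 0)"
  by transfer (auto simp: lookup_single when_def)

lemma finite_support: "finite {w. coeff x w \<noteq> 0}"
  by transfer simp

lemma tensor_power_iff: "x \<in> tensor_power m \<longleftrightarrow> (\<forall>w. coeff x w \<noteq> 0 \<longrightarrow> length w = m)"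
  unfolding tensor_power_def by (auto simp: coeff.rep_eq in_keys_iff)

lemma word_Nil [simp]: "word [] = 0"
  by transfer simp

lemma word_mult: "u \<noteq> [] \<Longrightarrow> v \<noteq> [] \<Longrightarrow> word u * word v = word (u @ v)"
  by transfer (simp add: mult_single plus_list_def)

lemma basis_a_word: "basis_a i = word [A i]" and basis_b_word: "basis_b i = word [B i]"
  by (transfer; simp)+

lemma tensor_expand:
  assumes "finite K" "{w. coeff x w \<noteq> 0} \<subseteq> K"
  shows "x = (\<Sum>w\<in>K. tensor_scale (coeff x w) (word w))"
proof (rule tensor_eqI)
  fix v
  have "coeff (\<Sum>w\<in>K. tensor_scale (coeff x w) (word w)) v
      = (\<Sum>w\<in>K. if w = v then coeff x v else 0)"
    unfolding coeff_sum by (rule sum.cong) (auto simp: coeff_word)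
  also have "\<dots> = coeff x v"
    using assms by (auto simp: sum.delta)
  finally show "coeff x v = coeff (\<Sum>w\<in>K. tensor_scale (coeff x w) (word w)) v" by simp
qed

lemma tensor_induct [case_names word zero add scale]:
  assumes "\<And>w. w \<noteq> [] \<Longrightarrow> P (word w)" "P 0" "\<And>x y. P x \<Longrightarrow> P y \<Longrightarrow> P (x + y)"
    "\<And>c x. P x \<Longrightarrow> P (tensor_scale c x)"
  shows "P x"
proof -
  have "P (\<Sum>w\<in>K. tensor_scale (coeff x w) (word w))" if "finite K" for K
    using that
  proof induction
    case (insert w K)
    have "P (word w)" using assms(1,2) by (cases "w = []") auto
    then show ?case using insert assms(3,4) by simp
  qed (use assms in simp)
  from this[OF finite_support] show ?thesis
    by (subst tensor_expand[OF finite_support order.refl])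
qed

lemma scale_mult_left: "tensor_scale c x * y = tensor_scale c (x * y)"
  by transfer (simp only: mult_map_scale_conv_mult mult.assoc)

lemma single_mult_scale:
  fixes q :: "'a letter list \<Rightarrow>\<^sub>0 rat"
  shows "Poly_Mapping.single w a * Poly_Mapping.map ((*) c) q
    = Poly_Mapping.map ((*) c) (Poly_Mapping.single w a * q)"
proof -
  have "Poly_Mapping.single w a * Poly_Mapping.single 0 c
      = Poly_Mapping.single 0 c * Poly_Mapping.single w a"
    by (simp only: mult_single add_0_left add_0_right mult.commute)
  then show ?thesis by (simp only: mult_map_scale_conv_mult mult.assoc[symmetric])
qed

lemma word_mult_scale: "word w * tensor_scale c y = tensor_scale c (word w * y)"
proof (cases "w = []")
  case False
  then show ?thesis by transfer (simp only: if_False single_mult_scale)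
qed simp

lemma scale_mult_right: "x * tensor_scale c y = tensor_scale c (x * y)"
proof (induction x rule: tensor_induct)
  case (word w)
  show ?case by (rule word_mult_scale)
next
  case (add x z)
  then show ?case by (simp only: distrib_right tensor.scale_right_distrib)
next
  case (scale d x)
  then show ?case by (simp add: scale_mult_left mult.commute)
qed simp

lemma sum_lessThan_split:
  "(\<Sum>i<m + n. g i) = (\<Sum>i<m. g i) + (\<Sum>i<n. g (m + i))" for g :: "nat \<Rightarrow> 'a::comm_monoid_add"
  by (induction n) (auto simp: add_ac)

section \<open>The symplectic form and the action of a cyclic word\<close>

lemma UNIV_letter: "UNIV = range A \<union> range B"
proof (rule UNIV_eq_I)
  fix x :: "'a letter"
  show "x \<in> range A \<union> range B" by (cases x) auto
qed

lemma finite_letters [simp]: "finite (UNIV :: 'n::finite letter set)"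
  by (simp add: UNIV_letter)

instance letter :: (finite) finite
  by standard simp

lemma sum_letters: "(\<Sum>x\<in>UNIV. h x) = (\<Sum>i\<in>UNIV. h (A i)) + (\<Sum>i\<in>UNIV. h (B i))"
  for h :: "'n::finite letter \<Rightarrow> 'a::comm_monoid_add"
proof -
  have "(\<Sum>x\<in>UNIV. h x) = sum h (range A) + sum h (range B)"
    unfolding UNIV_letter by (rule sum.union_disjoint) auto
  then show ?thesis by (simp add: sum.reindex inj_on_def)
qed

fun sgn_letter :: "'n letter \<Rightarrow> rat" where
  "sgn_letter (A i) = 1"
| "sgn_letter (B i) = - 1"

lemma sgn_letter_dual [simp]: "sgn_letter (dual x) = - sgn_letter x"
  by (cases x) auto

lemma sgn_letter_square [simp]: "sgn_letter x * sgn_letter x = 1" "sgn_letter x * (sgn_letter x * c) = c"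
  by (cases x; simp)+

text \<open>The symplectic form of \<open>H\<close> on the basis of letters.\<close>

definition pairing :: "'n letter \<Rightarrow> 'n letter \<Rightarrow> rat" where
  "pairing x y = (if y = dual x then sgn_letter x else 0)"

lemma pairing_antisym: "pairing y x = - pairing x y"
  by (auto simp: pairing_def)

lemma sum_pairing_left:
  "(\<Sum>y\<in>UNIV. tensor_scale (pairing x y) (h y)) = tensor_scale (sgn_letter x) (h (dual x))"
  for h :: "'n::finite letter \<Rightarrow> 'n tensor"
proof -
  have "(\<Sum>y\<in>UNIV. tensor_scale (pairing x y) (h y))
      = (\<Sum>y\<in>UNIV. if y = dual x then tensor_scale (sgn_letter x) (h y) else 0)"
    by (rule sum.cong) (auto simp: pairing_def)
  then show ?thesis by (simp add: sum.delta)
qed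

text \<open>Contracting one factor of a tensor of degree \<open>k + 2\<close> by the symplectic form
  gives a map from \<open>H\<close> to tensors of degree \<open>k + 1\<close>. The sum over
  rotations makes the tensor cyclically symmetric, and the sum over positions extends the map to
  words by the Leibniz rule.\<close>

definition substitute :: "'n letter list \<Rightarrow> 'n letter list \<Rightarrow> 'n tensor" where
  "substitute w z = (\<Sum>i<length z. \<Sum>r<length w.
     tensor_scale (pairing (z ! i) (hd (rotate r w))) (word (take i z @ tl (rotate r w) @ drop (Suc i) z)))"

definition cyclic_der :: "'n letter list \<Rightarrow> 'n tensor \<Rightarrow> 'n tensor" where
  "cyclic_der w x = (\<Sum>z | coeff x z \<noteq> 0. tensor_scale (coeff x z) (substitute w z))"

lemma cyclic_der_superset:
  assumes "finite K" "{z. coeff x z \<noteq> 0} \<subseteq> K"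
  shows "cyclic_der w x = (\<Sum>z\<in>K. tensor_scale (coeff x z) (substitute w z))"
  unfolding cyclic_der_def using assms by (intro sum.mono_neutral_left) auto

lemma cyclic_der_word: "z \<noteq> [] \<Longrightarrow> cyclic_der w (word z) = substitute w z"
  by (subst cyclic_der_superset[of "{z}"]) (auto simp: coeff_word)

lemma cyclic_der_add: "cyclic_der w (x + y) = cyclic_der w x + cyclic_der w y"
proof -
  let ?K = "{z. coeff x z \<noteq> 0} \<union> {z. coeff y z \<noteq> 0}"
  have K: "finite ?K" using finite_support by blast
  show ?thesis
    using K by (subst (1 2 3) cyclic_der_superset[of ?K])
      (auto simp: tensor.scale_left_distrib sum.distrib)
qed

lemma cyclic_der_scale: "cyclic_der w (tensor_scale c x) = tensor_scale c (cyclic_der w x)"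
  by (subst (1 2) cyclic_der_superset[of "{z. coeff x z \<noteq> 0}"])
    (auto simp: finite_support tensor.scale_sum_right)

lemma linear_cyclic_der: "Vector_Spaces.linear tensor_scale tensor_scale (cyclic_der w)"
  unfolding Vector_Spaces.linear_iff using tensor.vector_space_axioms
  by (auto simp: cyclic_der_add cyclic_der_scale)

lemma tl_rotate_nonempty: "2 \<le> length w \<Longrightarrow> tl (rotate r w) \<noteq> []"
  by (metis One_nat_def Suc_1 Suc_le_lessD diff_is_0_eq length_rotate length_tl list.size(3) not_less)

text \<open>The Leibniz rule on words. Two letters in \<open>w\<close> ensure that the inserted word
  is nonempty; contracting a word of one letter would leave a scalar, for which there is no room
  here.\<close>

lemma substitute_append:
  assumes "2 \<le> length w" "z \<noteq> []" "z' \<noteq> []"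
  shows "substitute w (z @ z') = substitute w z * word z' + word z * substitute w z'"
proof -
  have "substitute w (z @ z') = (\<Sum>i<length z. \<Sum>r<length w.
     tensor_scale (pairing (z ! i) (hd (rotate r w)))
       (word (take i z @ tl (rotate r w) @ drop (Suc i) z) * word z'))
   + (\<Sum>i<length z'. \<Sum>r<length w.
     tensor_scale (pairing (z' ! i) (hd (rotate r w)))
       (word z * word (take i z' @ tl (rotate r w) @ drop (Suc i) z')))"
    unfolding substitute_def length_append sum_lessThan_split using assms
    by (intro arg_cong2[where f = "(+)"] sum.cong refl)
      (auto simp: nth_append word_mult tl_rotate_nonempty)
  also have "\<dots> = substitute w z * word z' + word z * substitute w z'"
    by (simp add: substitute_def sum_distrib_left sum_distrib_right scale_mult_left scale_mult_right)
  finally show ?thesis .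
qed

lemma derivation_cyclic_der:
  assumes "2 \<le> length w"
  shows "derivation (cyclic_der w)"
proof -
  have "cyclic_der w (x * y) = cyclic_der w x * y + x * cyclic_der w y" for x y
  proof (induction x rule: tensor_induct)
    case (word u)
    show ?case
    proof (induction y rule: tensor_induct)
      case (word v)
      then show ?case
        using \<open>u \<noteq> []\<close> assms by (simp add: word_mult cyclic_der_word substitute_append)
    next
      case zero
      then show ?case using cyclic_der_scale[of w 0 0] by simp
    next
      case (add x y)
      then show ?case by (simp add: distrib_left cyclic_der_add algebra_simps)
    next
      case (scale c x)
      then show ?case
        by (simp add: scale_mult_right cyclic_der_scale tensor.scale_right_distrib)
    qed
  next
    case zero
    then show ?case using cyclic_der_scale[of w 0 0] by simp
  next
    case (add x y)
    then show ?case by (simp add: distrib_right cyclic_der_add algebra_simps)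
  next
    case (scale c x)
    then show ?case
      by (simp add: scale_mult_left cyclic_der_scale tensor.scale_right_distrib)
  qed
  then show ?thesis unfolding derivation_def using linear_cyclic_der by blast
qed

section \<open>Derivations, their brackets and weights\<close>

lemma derivation_add: "derivation D \<Longrightarrow> D (x + y) = D x + D y"
  and derivation_scale: "derivation D \<Longrightarrow> D (tensor_scale c x) = tensor_scale c (D x)"
  and derivation_mult: "derivation D \<Longrightarrow> D (x * y) = D x * y + x * D y"
  unfolding derivation_def Vector_Spaces.linear_iff by auto

lemma derivation_zero: "derivation D \<Longrightarrow> D 0 = 0"
  using derivation_scale[of D 0 0] by simp

lemma derivation_sum: "derivation D \<Longrightarrow> D (sum x I) = (\<Sum>i\<in>I. D (x i))"
  by (induction I rule: infinite_finite_induct) (auto simp: derivation_add derivation_zero)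

lemma derivation_diff: "derivation D \<Longrightarrow> D (x - y) = D x - D y"
  by (metis add_diff_cancel_right' derivation_add diff_add_cancel)

lemma derivation_eqI:
  assumes "derivation D" "derivation E" "\<And>x. D (word [x]) = E (word [x])"
  shows "D = E"
proof
  fix y show "D y = E y"
  proof (induction y rule: tensor_induct)
    case (word w)
    then show ?case
    proof (induction w)
      case (Cons x w)
      show ?case
      proof (cases "w = []")
        case False
        then have "word (x # w) = word [x] * word w" by (simp add: word_mult)
        then show ?thesis using Cons False assms by (simp add: derivation_mult)
      qed (use assms in simp)
    qed simp
  qed (use assms in \<open>simp_all add: derivation_add derivation_scale derivation_zero\<close>)
qed

lemma derivationI:
  assumes "\<And>x y. D (x + y) = D x + D y" "\<And>c x. D (tensor_scale c x) = tensor_scale c (D x)"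
    "\<And>x y. D (x * y) = D x * y + x * D y"
  shows "derivation D"
  unfolding derivation_def Vector_Spaces.linear_iff using assms tensor.vector_space_axioms by auto

lemma subspace_derivations: "operator.subspace {D. derivation D}"
  unfolding operator.subspace_def
  by (auto intro!: derivationI
      simp: derivation_add derivation_scale derivation_mult operator_scale_def
        tensor.scale_right_distrib scale_mult_left scale_mult_right distrib_left distrib_right
        algebra_simps)

lemma bracket_apply: "bracket F G x = F (G x) - G (F x)"
  by (simp add: bracket_def)

lemma derivation_bracket: "derivation F \<Longrightarrow> derivation G \<Longrightarrow> derivation (bracket F G)"
  by (rule derivationI)
    (simp_all add: bracket_apply derivation_add derivation_scale derivation_mult
      tensor.scale_right_diff_distrib algebra_simps)

lemma subspace_tensor_power: "tensor.subspace (tensor_power m)"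
proof -
  have "length w = m" if "coeff x w + coeff y w \<noteq> 0"
    "\<forall>w. coeff x w \<noteq> 0 \<longrightarrow> length w = m" "\<forall>w. coeff y w \<noteq> 0 \<longrightarrow> length w = m" for x y :: "'a tensor" and w
    using that by (cases "coeff x w = 0") auto
  then show ?thesis by (simp add: tensor.subspace_def tensor_power_iff)
qed

lemma word_tensor_power: "word w \<in> tensor_power (length w)"
  by (auto simp: tensor_power_iff coeff_word)

lemma tensor_power_expand:
  fixes x :: "'n::finite tensor"
  assumes "x \<in> tensor_power m"
  shows "x = (\<Sum>w | length w = m. tensor_scale (coeff x w) (word w))"
  using assms finite_lists_length_eq[of "UNIV :: 'n letter set" m]
  by (intro tensor_expand) (auto simp: tensor_power_iff)

lemma tensor_power_mult:
  fixes x y :: "'n::finite tensor"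
  assumes "x \<in> tensor_power m" "y \<in> tensor_power n"
  shows "x * y \<in> tensor_power (m + n)"
proof -
  have "x * y = (\<Sum>u | length u = m. \<Sum>v | length v = n.
      tensor_scale (coeff y v) (tensor_scale (coeff x u) (word u * word v)))"
    by (subst tensor_power_expand[OF assms(1)], subst tensor_power_expand[OF assms(2)])
      (simp only: sum_product scale_mult_left scale_mult_right)
  moreover have "word u * word v \<in> tensor_power (length u + length v)" for u v :: "'n letter list"
    using word_tensor_power[of "u @ v"] tensor.subspace_0[OF subspace_tensor_power]
    by (cases "u = []"; cases "v = []") (auto simp: word_mult)
  ultimately show ?thesis
    by (auto intro!: tensor.subspace_sum tensor.subspace_scale subspace_tensor_power)
qed

lemma derivation_tensor_power:
  fixes D :: "'n::finite tensor \<Rightarrow> 'n tensor"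
  assumes "derivation D" "D ` tensor_power 1 \<subseteq> tensor_power (k + 1)" "x \<in> tensor_power m"
  shows "D x \<in> tensor_power (m + k)"
proof -
  have D: "D (word w) \<in> tensor_power (length w + k)" for w
  proof (induction w)
    case Nil
    then show ?case
      using assms(1) tensor.subspace_0[OF subspace_tensor_power] by (simp add: derivation_zero)
  next
    case (Cons y w)
    have y: "D (word [y]) \<in> tensor_power (k + 1)"
      using assms(2) word_tensor_power[of "[y]"] by auto
    show ?case
    proof (cases "w = []")
      case False
      then have "D (word (y # w)) = D (word [y]) * word w + word [y] * D (word w)"
        using word_mult[of "[y]" w] derivation_mult[OF assms(1)] by (metis append_Cons append_Nil list.discI)
      moreover have "D (word [y]) * word w \<in> tensor_power ((k + 1) + length w)"
        using y word_tensor_power by (rule tensor_power_mult)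
      moreover have "word [y] * D (word w) \<in> tensor_power (length [y] + (length w + k))"
        using word_tensor_power Cons by (rule tensor_power_mult)
      ultimately show ?thesis
        using tensor.subspace_add[OF subspace_tensor_power] by (simp add: add_ac)
    qed (use y in \<open>simp add: add_ac\<close>)
  qed
  have "D x = (\<Sum>w | length w = m. tensor_scale (coeff x w) (D (word w)))"
    by (subst tensor_power_expand[OF assms(3)])
      (simp add: derivation_sum[OF assms(1)] derivation_scale[OF assms(1)])
  then show ?thesis
    using D by (auto intro!: tensor.subspace_sum tensor.subspace_scale subspace_tensor_power)
qed

lemma subspace_sympl_der_weight: "operator.subspace (sympl_der_weight k)"
proof -
  have "sympl_der_weight k = {D. derivation D} \<inter> {D. D omega0 = 0}
      \<inter> {D. D ` tensor_power 1 \<subseteq> tensor_power (k + 1)}"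
    by (auto simp: sympl_der_weight_def sympl_der_def)
  moreover have "operator.subspace {D. D omega0 = 0}"
    by (auto simp: operator.subspace_def operator_scale_def)
  moreover have "operator.subspace {D. D ` tensor_power 1 \<subseteq> tensor_power (k + 1)}"
    using subspace_tensor_power
    by (auto simp: operator.subspace_def operator_scale_def tensor.subspace_def image_subset_iff)
  ultimately show ?thesis
    using operator.subspace_inter subspace_derivations by metis
qed

lemma bracket_weight:
  assumes "F \<in> sympl_der_weight i" "G \<in> sympl_der_weight j"
  shows "bracket F G \<in> sympl_der_weight (i + j)"
proof -
  have F: "derivation F" "F omega0 = 0" "F ` tensor_power 1 \<subseteq> tensor_power (i + 1)"
    and G: "derivation G" "G omega0 = 0" "G ` tensor_power 1 \<subseteq> tensor_power (j + 1)"
    using assms by (auto simp: sympl_der_weight_def sympl_der_def)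
  have "bracket F G x \<in> tensor_power (i + j + 1)" if "x \<in> tensor_power 1" for x
  proof -
    have "F (G x) \<in> tensor_power (1 + j + i)" "G (F x) \<in> tensor_power (1 + i + j)"
      using derivation_tensor_power[OF F(1,3) derivation_tensor_power[OF G(1,3) that]]
        derivation_tensor_power[OF G(1,3) derivation_tensor_power[OF F(1,3) that]] by simp_all
    then show ?thesis
      using tensor.subspace_diff[OF subspace_tensor_power] by (simp add: bracket_def add_ac)
  qed
  then show ?thesis
    using derivation_bracket F G
    by (auto simp: sympl_der_weight_def sympl_der_def bracket_def derivation_zero)
qed

lemma omega0_word: "omega0 = (\<Sum>x\<in>UNIV. tensor_scale (sgn_letter x) (word [x, dual x]))"
  unfolding omega0_def sum_letters
  by (simp add: sum_subtractf basis_a_word basis_b_word word_mult sum_negf)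

lemma sum_pairing_right:
  "(\<Sum>x\<in>UNIV. tensor_scale (sgn_letter x) (tensor_scale (pairing x y) (h x))) = h (dual y)"
  "(\<Sum>x\<in>UNIV. tensor_scale (sgn_letter x) (tensor_scale (pairing (dual x) y) (h x))) = - h y"
  for h :: "'n::finite letter \<Rightarrow> 'n tensor"
proof -
  have "(\<Sum>x\<in>UNIV. tensor_scale (sgn_letter x) (tensor_scale (pairing x y) (h x)))
      = (\<Sum>x\<in>UNIV. if x = dual y then h x else 0)"
    by (rule sum.cong) (auto simp: pairing_def)
  then show "(\<Sum>x\<in>UNIV. tensor_scale (sgn_letter x) (tensor_scale (pairing x y) (h x))) = h (dual y)"
    by (simp add: sum.delta)
  have "(\<Sum>x\<in>UNIV. tensor_scale (sgn_letter x) (tensor_scale (pairing (dual x) y) (h x)))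
      = (\<Sum>x\<in>UNIV. if x = y then - h x else 0)"
    by (rule sum.cong) (auto simp: pairing_def)
  then show "(\<Sum>x\<in>UNIV. tensor_scale (sgn_letter x) (tensor_scale (pairing (dual x) y) (h x))) = - h y"
    by (simp add: sum.delta)
qed

lemma cyclic_der_letter:
  "cyclic_der w (word [x])
    = (\<Sum>r<length w. tensor_scale (pairing x (hd (rotate r w))) (word (tl (rotate r w))))"
  by (simp add: cyclic_der_word substitute_def)

text \<open>Contracting a rotation of \<open>w\<close> with the first factors of
  \<open>omega0\<close> gives the next rotation, with the second factors minus the rotation itself.
  The sum telescopes around the cycle.\<close>

lemma cyclic_der_omega0:
  assumes "2 \<le> length w"
  shows "cyclic_der w omega0 = 0"
proof -
  note der = derivation_cyclic_der[OF assms]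
  have "cyclic_der w omega0 = (\<Sum>x\<in>UNIV. tensor_scale (sgn_letter x) (substitute w [x, dual x]))"
    by (simp add: omega0_word derivation_sum[OF der] derivation_scale[OF der] cyclic_der_word)
  also have "\<dots> = (\<Sum>x\<in>UNIV. \<Sum>r<length w.
      tensor_scale (sgn_letter x) (tensor_scale (pairing x (hd (rotate r w)))
        (word (tl (rotate r w) @ [dual x])))
    + tensor_scale (sgn_letter x) (tensor_scale (pairing (dual x) (hd (rotate r w)))
        (word ([x] @ tl (rotate r w)))))"
    by (simp add: substitute_def tensor.scale_sum_right sum.distrib tensor.scale_right_distrib
        del: tensor.scale_scale)
  also have "\<dots> = (\<Sum>r<length w.
      word (tl (rotate r w) @ [hd (rotate r w)]) - word (hd (rotate r w) # tl (rotate r w)))"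
    by (subst sum.swap) (simp add: sum.distrib sum_pairing_right del: tensor.scale_scale)
  also have "\<dots> = (\<Sum>r<length w. word (rotate (Suc r) w) - word (rotate r w))"
  proof (rule sum.cong)
    fix r assume "r \<in> {..<length w}"
    then have "rotate r w \<noteq> []" by auto
    then show "word (tl (rotate r w) @ [hd (rotate r w)]) - word (hd (rotate r w) # tl (rotate r w))
        = word (rotate (Suc r) w) - word (rotate r w)"
      by (cases "rotate r w") auto
  qed simp
  also have "\<dots> = 0"
    by (subst sum_lessThan_telescope) (simp add: rotate_id)
  finally show ?thesis .
qed

lemma cyclic_der_weight:
  assumes "length w = k + 2"
  shows "cyclic_der w \<in> sympl_der_weight k"
proof -
  have "cyclic_der w x \<in> tensor_power (k + 1)" if "x \<in> tensor_power 1" for x :: "'a tensor"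
  proof -
    have "substitute w z \<in> tensor_power (k + 1)" if z: "length z = 1" for z
    proof -
      obtain y where "z = [y]" using z by (cases z) auto
      moreover have "word (tl (rotate r w)) \<in> tensor_power (k + 1)" for r
        using word_tensor_power[of "tl (rotate r w)"] assms by simp
      ultimately show ?thesis
        by (auto simp: substitute_def
            intro!: tensor.subspace_sum tensor.subspace_scale subspace_tensor_power)
    qed
    then show ?thesis
      unfolding cyclic_der_def using that
      by (auto intro!: tensor.subspace_sum tensor.subspace_scale subspace_tensor_power simp: tensor_power_iff[of x])
  qed
  then show ?thesis
    using assms derivation_cyclic_der[of w] cyclic_der_omega0[of w]
    by (auto simp: sympl_der_weight_def sympl_der_def)
qed

section \<open>The necklace bracket\<close>

lemma sum_rotate_shift:
  fixes h :: "'b list \<Rightarrow> 'a::ab_group_add"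
  shows "(\<Sum>r<length w. h (rotate c (rotate r w))) = (\<Sum>r<length w. h (rotate r w))"
proof -
  have *: "(\<Sum>r<length w. h (rotate (Suc r) w)) = (\<Sum>r<length w. h (rotate r w))" for h :: "'b list \<Rightarrow> 'a"
  proof -
    have "(\<Sum>r<length w. h (rotate (Suc r) w)) - (\<Sum>r<length w. h (rotate r w))
        = h (rotate (length w) w) - h (rotate 0 w)"
      unfolding sum_subtractf[symmetric] by (rule sum_lessThan_telescope)
    then show ?thesis by (simp add: rotate_id)
  qed
  show ?thesis
  proof (induction c)
    case (Suc c)
    have "rotate (Suc c) (rotate r w) = rotate c (rotate (Suc r) w)" for r
      by (simp only: rotate_rotate) simp
    then show ?case using *[of "\<lambda>v. h (rotate c v)"] Suc by simp
  qed simp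
qed

lemma rotate_split:
  assumes "Suc j < length v"
  shows "rotate (Suc j) v = tl v ! j # drop (Suc j) (tl v) @ hd v # take j (tl v)"
proof -
  obtain y t where v: "v = y # t" "j < length t" using assms by (cases v) auto
  then have "rotate (Suc j) v = drop j t @ y # take j t"
    by (simp add: rotate_drop_take del: rotate_Suc)
  then show ?thesis using v by (simp add: Cons_nth_drop_Suc)
qed

text \<open>In the composite, \<open>x\<close> meets one letter of \<open>v\<close>, and another
  letter of \<open>v\<close> meets one of \<open>u\<close>. Unfolding reads \<open>v\<close> from
  the letter that meets \<open>x\<close>; the formula reads it from the letter that meets
  \<open>u\<close>, as the bracket does.\<close>

lemma cyclic_der_compose_letter:
  fixes u v :: "'n::finite letter list"
  assumes "2 \<le> length u" "2 \<le> length v"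
  shows "cyclic_der u (cyclic_der v (word [x])) =
    - (\<Sum>p<length u. \<Sum>q<length v. \<Sum>j<length v - 1.
        tensor_scale (pairing (hd (rotate p u)) (hd (rotate q v)) * pairing x (tl (rotate q v) ! j))
         (word (drop (Suc j) (tl (rotate q v)) @ tl (rotate p u) @ take j (tl (rotate q v)))))"
proof -
  note der = derivation_cyclic_der[OF assms(1)]
  define m where "m = length v - 1"
  define G where "G u' i t = tensor_scale (pairing x (hd t) * pairing (tl t ! i) (hd u'))
    (word (take i (tl t) @ tl u' @ drop (Suc i) (tl t)))" for u' t :: "'n letter list" and i
  define H where "H u' j t = tensor_scale (pairing (hd u') (hd t) * pairing x (tl t ! j))
    (word (drop (Suc j) (tl t) @ tl u' @ take j (tl t)))" for u' t :: "'n letter list" and j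
  have GH: "G u' (m - Suc j) (rotate (Suc j) t) = - H u' j t"
    if "j < m" "length t = length v" for u' j t
  proof -
    have r: "rotate (Suc j) t = tl t ! j # drop (Suc j) (tl t) @ hd t # take j (tl t)"
      using that by (intro rotate_split) (simp add: m_def)
    have l: "length (drop (Suc j) (tl t)) = m - Suc j"
      using that by (simp add: m_def)
    show ?thesis
      unfolding G_def H_def r using l
      by (simp add: nth_append pairing_antisym[of "hd t"] mult.commute)
  qed
  have "cyclic_der u (cyclic_der v (word [x]))
      = (\<Sum>r<length v. \<Sum>i<m. \<Sum>p<length u. G (rotate p u) i (rotate r v))"
    using assms(2) tl_rotate_nonempty[OF assms(2)]
    by (simp add: cyclic_der_letter[of v] derivation_sum[OF der] derivation_scale[OF der]
        cyclic_der_word substitute_def tensor.scale_sum_right G_def m_def)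
  also have "\<dots> = (\<Sum>p<length u. \<Sum>i<m. \<Sum>r<length v. G (rotate p u) i (rotate r v))"
    by (subst sum.swap, subst (2) sum.swap, subst sum.swap) (rule refl)
  also have "\<dots> = (\<Sum>p<length u. \<Sum>j<m. \<Sum>r<length v. G (rotate p u) (m - Suc j) (rotate r v))"
    by (rule sum.cong[OF refl], rule sum.nat_diff_reindex[symmetric])
  also have "\<dots> = (\<Sum>p<length u. \<Sum>j<m. \<Sum>r<length v. G (rotate p u) (m - Suc j) (rotate (Suc j) (rotate r v)))"
    by (rule sum.cong[OF refl], rule sum.cong[OF refl], rule sum_rotate_shift[symmetric])
  also have "\<dots> = (\<Sum>p<length u. \<Sum>j<m. \<Sum>r<length v. - H (rotate p u) j (rotate r v))"
    by (intro sum.cong refl GH) auto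
  also have "\<dots> = - (\<Sum>p<length u. \<Sum>r<length v. \<Sum>j<m. H (rotate p u) j (rotate r v))"
    unfolding sum_negf by (intro arg_cong[where f = uminus] sum.cong[OF refl] sum.swap)
  finally show ?thesis unfolding H_def m_def .
qed

lemma cyclic_der_append_letter:
  "cyclic_der (u @ v) (word [x]) =
    (\<Sum>j<length u. tensor_scale (pairing x (u ! j)) (word (drop (Suc j) u @ v @ take j u)))
    + (\<Sum>j<length v. tensor_scale (pairing x (v ! j)) (word (drop (Suc j) v @ u @ take j v)))"
proof -
  have "rotate j (u @ v) = u ! j # drop (Suc j) u @ v @ take j u" if "j < length u" for j
    using that by (simp add: rotate_drop_take Cons_nth_drop_Suc[symmetric])
  moreover have "rotate (length u + j) (u @ v) = v ! j # drop (Suc j) v @ u @ take j v"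
    if "j < length v" for j
    using that by (simp add: rotate_drop_take Cons_nth_drop_Suc[symmetric])
  ultimately show ?thesis
    unfolding cyclic_der_letter length_append sum_lessThan_split
    by (intro arg_cong2[where f = "(+)"] sum.cong refl) auto
qed

text \<open>On a letter, one composite gives the terms in which the letter meets the rest of
  \<open>v\<close>, the other those in which it meets the rest of \<open>u\<close>. By
  \<open>cyclic_der_append_letter\<close> they add up to the derivation of the two rests
  joined.\<close>

lemma bracket_cyclic_der:
  fixes u v :: "'n::finite letter list"
  assumes "2 \<le> length u" "2 \<le> length v"
  shows "bracket (cyclic_der u) (cyclic_der v) =
    - (\<Sum>p<length u. \<Sum>q<length v.
        operator_scale (pairing (hd (rotate p u)) (hd (rotate q v)))
          (cyclic_der (tl (rotate p u) @ tl (rotate q v))))"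
proof (rule derivation_eqI)
  show "derivation (bracket (cyclic_der u) (cyclic_der v))"
    using assms by (intro derivation_bracket derivation_cyclic_der)
  have "derivation (cyclic_der (tl (rotate p u) @ tl (rotate q v)))" for p q
    using assms by (intro derivation_cyclic_der) simp
  then have "- (\<Sum>p<length u. \<Sum>q<length v.
        operator_scale (pairing (hd (rotate p u)) (hd (rotate q v)))
          (cyclic_der (tl (rotate p u) @ tl (rotate q v)))) \<in> {D. derivation D}"
    by (intro operator.subspace_neg operator.subspace_sum operator.subspace_scale
        subspace_derivations) simp
  then show "derivation (- (\<Sum>p<length u. \<Sum>q<length v.
        operator_scale (pairing (hd (rotate p u)) (hd (rotate q v)))
          (cyclic_der (tl (rotate p u) @ tl (rotate q v)))))"
    by simp
next
  fix x
  let ?P = "\<lambda>p q. pairing (hd (rotate p u)) (hd (rotate q v))"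
  let ?L = "\<lambda>p q. \<Sum>j<length u - 1. tensor_scale (?P p q * pairing x (tl (rotate p u) ! j))
         (word (drop (Suc j) (tl (rotate p u)) @ tl (rotate q v) @ take j (tl (rotate p u))))"
  let ?R = "\<lambda>p q. \<Sum>j<length v - 1. tensor_scale (?P p q * pairing x (tl (rotate q v) ! j))
         (word (drop (Suc j) (tl (rotate q v)) @ tl (rotate p u) @ take j (tl (rotate q v))))"
  have "cyclic_der v (cyclic_der u (word [x])) = (\<Sum>q<length v. \<Sum>p<length u. ?L p q)"
    unfolding cyclic_der_compose_letter[OF assms(2,1)]
    by (simp add: sum_negf[symmetric] pairing_antisym[of "hd (rotate _ v)"])
  also have "\<dots> = (\<Sum>p<length u. \<Sum>q<length v. ?L p q)"
    by (rule sum.swap)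
  finally have "bracket (cyclic_der u) (cyclic_der v) (word [x])
      = - (\<Sum>p<length u. \<Sum>q<length v. ?R p q) - (\<Sum>p<length u. \<Sum>q<length v. ?L p q)"
    unfolding bracket_apply cyclic_der_compose_letter[OF assms] by (rule arg_cong)
  also have "\<dots> = - (\<Sum>p<length u. \<Sum>q<length v. ?L p q + ?R p q)"
    by (simp add: sum.distrib)
  also have "\<dots> = - (\<Sum>p<length u. \<Sum>q<length v. tensor_scale (?P p q)
      (cyclic_der (tl (rotate p u) @ tl (rotate q v)) (word [x])))"
    by (simp add: cyclic_der_append_letter tensor.scale_right_distrib tensor.scale_sum_right)
  also have "\<dots> = (- (\<Sum>p<length u. \<Sum>q<length v.
        operator_scale (?P p q) (cyclic_der (tl (rotate p u) @ tl (rotate q v))))) (word [x])"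
  proof -
    have sum_apply: "(\<Sum>i\<in>I. F i) y = (\<Sum>i\<in>I. F i y)" for F :: "nat \<Rightarrow> 'n tensor \<Rightarrow> 'n tensor" and I y
      by (induction I rule: infinite_finite_induct) auto
    show ?thesis by (simp add: sum_apply operator_scale_def)
  qed
  finally show "bracket (cyclic_der u) (cyclic_der v) (word [x]) = \<dots>" .
qed

section \<open>Cyclic words span the symplectic derivations\<close>

lemma coeff_letter_mult: "coeff (word [y] * x) (z # v) = (if y = z then coeff x v else 0)"
  by (induction x rule: tensor_induct)
    (auto simp: word_mult coeff_word distrib_left scale_mult_right)

lemma coeff_mult_letter: "coeff (x * word [y]) (v @ [z]) = (if y = z then coeff x v else 0)"
  by (induction x rule: tensor_induct)
    (auto simp: word_mult coeff_word distrib_right scale_mult_left)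

text \<open>
  The tensor \<open>\<Sum>\<^sub>i D a\<^sub>i \<otimes> b\<^sub>i - D b\<^sub>i \<otimes> a\<^sub>i\<close> determines \<open>D\<close>, and \<open>D \<omega>\<^sub>0 = 0\<close> says that it is invariant
  under rotation.
\<close>

lemma cyclic_coefficients:
  fixes D :: "'n::finite tensor \<Rightarrow> 'n tensor"
  assumes "derivation D" "D omega0 = 0"
  obtains c where "\<And>w. c (rotate1 w) = c w"
    "\<And>y v. c (y # v) = - (sgn_letter y * coeff (D (word [dual y])) v)"
proof -
  define S where "S = (\<Sum>x\<in>UNIV. tensor_scale (sgn_letter x) (D (word [x]) * word [dual x]))"
  define T where "T = (\<Sum>x\<in>UNIV. tensor_scale (sgn_letter x) (word [dual x] * D (word [x])))"
  have "D (word [x, y]) = D (word [x]) * word [y] + word [x] * D (word [y])" for x y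
    using derivation_mult[OF assms(1), of "word [x]" "word [y]"] by (simp add: word_mult)
  then have "D omega0 = (\<Sum>x\<in>UNIV. tensor_scale (sgn_letter x)
      (D (word [x]) * word [dual x] + word [x] * D (word [dual x])))"
    by (simp add: omega0_word derivation_sum[OF assms(1)] derivation_scale[OF assms(1)])
  also have "\<dots> = S + (\<Sum>x\<in>UNIV. tensor_scale (sgn_letter x) (word [x] * D (word [dual x])))"
    by (simp add: S_def tensor.scale_right_distrib sum.distrib)
  also have "(\<Sum>x\<in>UNIV. tensor_scale (sgn_letter x) (word [x] * D (word [dual x])))
      = (\<Sum>x\<in>UNIV. tensor_scale (sgn_letter (dual x)) (word [dual x] * D (word [x])))"
    by (rule sum.reindex_bij_witness[of _ dual dual]) auto
  also have "\<dots> = - T"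
    by (simp add: T_def sum_negf)
  finally have "S = T" using assms(2) by simp
  have T: "coeff T (y # v) = - (sgn_letter y * coeff (D (word [dual y])) v)" for y v
  proof -
    have "coeff T (y # v)
        = (\<Sum>x\<in>UNIV. if x = dual y then sgn_letter x * coeff (D (word [x])) v else 0)"
      unfolding T_def coeff_sum by (rule sum.cong) (auto simp: coeff_letter_mult)
    then show ?thesis by (simp add: sum.delta)
  qed
  have S: "coeff S (v @ [y]) = - (sgn_letter y * coeff (D (word [dual y])) v)" for y v
  proof -
    have "coeff S (v @ [y])
        = (\<Sum>x\<in>UNIV. if x = dual y then sgn_letter x * coeff (D (word [x])) v else 0)"
      unfolding S_def coeff_sum by (rule sum.cong) (auto simp: coeff_mult_letter)
    then show ?thesis by (simp add: sum.delta)
  qed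
  \<comment> \<open>\<open>T\<close> and \<open>S\<close> carry the same coefficients, with the
    letter \<open>y\<close> in front and at the end respectively, so \<open>S = T\<close> is the
    invariance under rotation.\<close>
  have "coeff T (rotate1 w) = coeff T w" for w
    using S T \<open>S = T\<close> by (cases w) auto
  then show ?thesis using T that by blast
qed

lemma sum_operator_apply: "(\<Sum>i\<in>I. F i) y = (\<Sum>i\<in>I. F i y)"
  for F :: "'b \<Rightarrow> 'n tensor \<Rightarrow> 'n tensor"
  by (induction I rule: infinite_finite_induct) auto

lemma finite_words [simp]: "finite {w :: 'n::finite letter list. length w = m}"
  using finite_lists_length_eq[of "UNIV :: 'n letter set" m] by simp

lemma sum_words_Suc:
  "(\<Sum>w | length w = Suc m. h w) = (\<Sum>y\<in>UNIV. \<Sum>v | length v = m. h (y # v))"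
  for h :: "'n::finite letter list \<Rightarrow> 'a::comm_monoid_add"
proof -
  have "(\<Sum>w | length w = Suc m. h w)
      = (\<Sum>(y, v)\<in>UNIV \<times> {v. length v = m}. h (y # v))"
    by (rule sum.reindex_bij_witness[of _ "\<lambda>(y, v). y # v" "\<lambda>w. (hd w, tl w)"])
      (auto simp: length_Suc_conv)
  then show ?thesis by (simp add: sum.cartesian_product)
qed

lemma sum_words_rotate:
  "(\<Sum>w | length w = m. h (rotate r w)) = (\<Sum>w | length w = m. h w)"
  for h :: "'n::finite letter list \<Rightarrow> 'a::comm_monoid_add"
proof -
  have "inj (rotate r :: 'n letter list \<Rightarrow> _)"
    unfolding rotate_def by (intro inj_fn inj_rotate1)
  then have "inj_on (rotate r) {w :: 'n letter list. length w = m}"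
    by (rule inj_on_subset) simp
  moreover from this have "rotate r ` {w :: 'n letter list. length w = m} = {w. length w = m}"
    by (intro endo_inj_surj) auto
  ultimately have "bij_betw (rotate r) {w :: 'n letter list. length w = m} {w. length w = m}"
    by (simp add: bij_betw_def)
  then show ?thesis by (rule sum.reindex_bij_betw)
qed

text \<open>With the rotation invariant coefficients \<open>c\<close> of
  \<open>cyclic_coefficients\<close>, the sum of \<open>c w\<close> times
  \<open>cyclic_der w\<close> over all words is \<open>k + 2\<close> times \<open>D\<close>, because
  each \<open>cyclic_der w\<close> runs through all \<open>k + 2\<close> rotations of
  \<open>w\<close>.\<close>

lemma sympl_der_weight_span:
  fixes D :: "'n::finite tensor \<Rightarrow> 'n tensor"
  assumes "D \<in> sympl_der_weight k"
  shows "D \<in> operator.span {cyclic_der w | w. length w = k + 2}"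
proof -
  have der: "derivation D" and D: "D omega0 = 0" "D ` tensor_power 1 \<subseteq> tensor_power (k + 1)"
    using assms by (auto simp: sympl_der_weight_def sympl_der_def)
  obtain c where rot1: "\<And>w. c (rotate1 w) = c w"
    and c: "\<And>y v. c (y # v) = - (sgn_letter y * coeff (D (word [dual y])) v)"
    using cyclic_coefficients[OF der D(1)] by blast
  have rot: "c (rotate r w) = c w" for r w
    by (induction r) (simp_all add: rot1)
  define n where "n = k + 2"
  have n: "n \<noteq> 0" "n = Suc (k + 1)" "2 \<le> n" by (simp_all add: n_def)
  let ?E = "\<Sum>w | length w = n. operator_scale (c w / of_nat n) (cyclic_der w)"
  have "D = ?E"
  proof (rule derivation_eqI[OF der])
    have "?E \<in> {D. derivation D}"
      using n(3) by (intro operator.subspace_sum operator.subspace_scale subspace_derivations)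
        (simp add: derivation_cyclic_der)
    then show "derivation ?E" by simp
  next
    fix x
    define h where "h w = tensor_scale (c w / of_nat n * pairing x (hd w)) (word (tl w))" for w
    have "?E (word [x]) = (\<Sum>w | length w = n. \<Sum>r<n. h (rotate r w))"
      unfolding sum_operator_apply operator_scale_def h_def
      by (rule sum.cong) (simp_all add: cyclic_der_letter tensor.scale_sum_right rot)
    also have "\<dots> = (\<Sum>r<n. \<Sum>w | length w = n. h (rotate r w))"
      by (rule sum.swap)
    also have "\<dots> = tensor_scale (of_nat n) (\<Sum>w | length w = n. h w)"
      unfolding sum_words_rotate by (simp only: tensor.sum_constant_scale card_lessThan)
    also have "\<dots> = (\<Sum>w | length w = Suc (k + 1). tensor_scale (c w * pairing x (hd w)) (word (tl w)))"
      using n(1) unfolding n(2)[symmetric] by (simp add: tensor.scale_sum_right h_def)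
    also have "\<dots> = (\<Sum>v | length v = k + 1. \<Sum>y\<in>UNIV.
        tensor_scale (pairing x y) (tensor_scale (c (y # v)) (word v)))"
      unfolding sum_words_Suc by (subst sum.swap) (simp add: mult.commute)
    also have "\<dots> = (\<Sum>v | length v = k + 1. tensor_scale (coeff (D (word [x])) v) (word v))"
      unfolding sum_pairing_left by (simp add: c)
    also have "\<dots> = D (word [x])"
      using D(2) word_tensor_power[of "[x]"] by (intro tensor_power_expand[symmetric]) auto
    finally show "D (word [x]) = ?E (word [x])" by simp
  qed
  also have "?E \<in> operator.span {cyclic_der w | w. length w = k + 2}"
    unfolding n_def by (intro operator.span_sum operator.span_scale operator.span_base) auto
  finally show ?thesis .
qed

section \<open>Decomposable derivations\<close>

abbreviation splittings :: "nat \<Rightarrow> (nat \<times> nat) set" where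
  "splittings k \<equiv> {(i, j). i + j = k \<and> 1 \<le> i \<and> 1 \<le> j}"

lemma finite_splittings: "finite (splittings k)"
  by (rule finite_subset[of _ "{..k} \<times> {..k}"]) auto

lemma decomposables_alt:
  "decomposables k = {sum s (splittings k) | s.
    \<forall>(i, j)\<in>splittings k. s (i, j) \<in> brackets (sympl_der_weight i) (sympl_der_weight j)}"
  unfolding decomposables_def set_sum_alt[OF finite_splittings] by (auto simp: case_prod_unfold)

lemma subspace_brackets: "operator.subspace (brackets U V)"
  by (simp add: brackets_def)

lemma subspace_decomposables: "operator.subspace (decomposables k)"
proof (rule operator.subspaceI)
  show "0 \<in> decomposables k"
    unfolding decomposables_alt
    by (intro CollectI exI[of _ "\<lambda>_. 0"]) (auto intro: operator.subspace_0 subspace_brackets)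
next
  fix x y :: "'a tensor \<Rightarrow> 'a tensor" assume "x \<in> decomposables k" "y \<in> decomposables k"
  then obtain s t where st: "x = sum s (splittings k)" "y = sum t (splittings k)"
    "\<forall>(i, j)\<in>splittings k. s (i, j) \<in> brackets (sympl_der_weight i) (sympl_der_weight j)"
    "\<forall>(i, j)\<in>splittings k. t (i, j) \<in> brackets (sympl_der_weight i) (sympl_der_weight j)"
    unfolding decomposables_alt by blast
  then show "x + y \<in> decomposables k"
    unfolding decomposables_alt
    by (intro CollectI exI[of _ "\<lambda>p. s p + t p"])
      (auto simp: sum.distrib intro: operator.subspace_add subspace_brackets)
next
  fix c and x :: "'a tensor \<Rightarrow> 'a tensor" assume "x \<in> decomposables k"
  then obtain s where st: "x = sum s (splittings k)"
    "\<forall>(i, j)\<in>splittings k. s (i, j) \<in> brackets (sympl_der_weight i) (sympl_der_weight j)"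
    unfolding decomposables_alt by blast
  then show "operator_scale c x \<in> decomposables k"
    unfolding decomposables_alt
    by (intro CollectI exI[of _ "\<lambda>p. operator_scale c (s p)"])
      (auto simp: operator.scale_sum_right intro: operator.subspace_scale subspace_brackets)
qed

lemma brackets_decomposable:
  assumes "1 \<le> i" "1 \<le> j" "i + j = k"
  shows "brackets (sympl_der_weight i) (sympl_der_weight j) \<subseteq> decomposables k"
proof
  fix x :: "'a tensor \<Rightarrow> 'a tensor"
  assume x: "x \<in> brackets (sympl_der_weight i) (sympl_der_weight j)"
  let ?s = "\<lambda>p. if p = (i, j) then x else 0"
  have "sum ?s (splittings k) = x"
    using assms finite_splittings[of k] by (simp add: sum.delta)
  then show "x \<in> decomposables k"
    unfolding decomposables_alt using x
    by (intro CollectI exI[of _ ?s]) (auto intro: operator.subspace_0 subspace_brackets)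
qed

lemma bracket_decomposable:
  assumes "F \<in> sympl_der_weight i" "G \<in> sympl_der_weight j" "1 \<le> i" "1 \<le> j" "i + j = k"
  shows "bracket F G \<in> decomposables k"
proof -
  have "bracket F G \<in> brackets (sympl_der_weight i) (sympl_der_weight j)"
    unfolding brackets_def using assms by (intro operator.span_base) auto
  then show ?thesis using brackets_decomposable[OF assms(3-5)] by blast
qed

lemma decomposables_induct [consumes 1, case_names subspace bracket]:
  assumes x: "x \<in> decomposables k" and V: "operator.subspace V"
    and "\<And>i j F G. 1 \<le> i \<Longrightarrow> 1 \<le> j \<Longrightarrow> i + j = k \<Longrightarrow> F \<in> sympl_der_weight i \<Longrightarrow>
      G \<in> sympl_der_weight j \<Longrightarrow> bracket F G \<in> V"
  shows "x \<in> V"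
proof -
  obtain s where s: "x = sum s (splittings k)"
    "\<forall>(i, j)\<in>splittings k. s (i, j) \<in> brackets (sympl_der_weight i) (sympl_der_weight j)"
    using x unfolding decomposables_alt by blast
  have "brackets (sympl_der_weight i) (sympl_der_weight j) \<subseteq> V" if "(i, j) \<in> splittings k" for i j
    unfolding brackets_def using that assms(3) by (intro operator.span_minimal V) auto
  then show ?thesis
    unfolding s(1) using s(2) by (intro operator.subspace_sum V) fastforce
qed

lemma decomposables_weight: "decomposables k \<subseteq> sympl_der_weight k"
proof
  fix x :: "'a tensor \<Rightarrow> 'a tensor" assume "x \<in> decomposables k"
  then show "x \<in> sympl_der_weight k"
    by (induction rule: decomposables_induct) (auto intro: subspace_sympl_der_weight bracket_weight)
qed

lemma bracket_add_right:
  "derivation E \<Longrightarrow> bracket E (F + G) = bracket E F + bracket E G"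
  by (rule ext) (simp add: bracket_apply derivation_add)

lemma bracket_scale_right:
  "derivation E \<Longrightarrow> bracket E (operator_scale c F) = operator_scale c (bracket E F)"
  by (rule ext)
    (simp add: bracket_apply operator_scale_def derivation_scale tensor.scale_right_diff_distrib)

lemma bracket_jacobi:
  assumes "derivation E" "derivation F" "derivation G"
  shows "bracket E (bracket F G) = bracket (bracket E F) G + bracket F (bracket E G)"
  using assms by (intro ext) (simp add: bracket_apply derivation_diff)

text \<open>By the Jacobi identity \<open>E\<close> acts on the factors of a bracket one at a time,
  and weight 0 preserves their weights.\<close>

lemma decomposables_bracket_zero:
  assumes E: "E \<in> sympl_der_weight 0" and "x \<in> decomposables k"
  shows "bracket E x \<in> decomposables k"
proof -
  have der: "derivation F" if "F \<in> sympl_der_weight i" for F :: "'a tensor \<Rightarrow> 'a tensor" and i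
    using that by (simp add: sympl_der_weight_def sympl_der_def)
  note E_der = der[OF E]
  have "x \<in> {x. bracket E x \<in> decomposables k}"
    using assms(2)
  proof (induction rule: decomposables_induct)
    case subspace
    have "bracket E 0 = 0"
      by (rule ext) (simp add: bracket_apply derivation_zero[OF E_der])
    then show ?case
      using subspace_decomposables
      by (auto simp: operator.subspace_def bracket_add_right[OF E_der] bracket_scale_right[OF E_der])
  next
    case (bracket i j F G)
    have "bracket E F \<in> sympl_der_weight i" "bracket E G \<in> sympl_der_weight j"
      using bracket_weight[OF E] bracket(4,5) by fastforce+
    then have "bracket (bracket E F) G \<in> decomposables k" "bracket F (bracket E G) \<in> decomposables k"
      using bracket by (auto intro: bracket_decomposable)
    then have "bracket (bracket E F) G + bracket F (bracket E G) \<in> decomposables k"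
      by (rule operator.subspace_add[OF subspace_decomposables])
    then show ?case
      unfolding bracket_jacobi[OF E_der der[OF bracket(4)] der[OF bracket(5)], symmetric] by simp
  qed
  then show ?thesis by simp
qed

text \<open>A basis of \<open>S\<close> stays independent after adding \<open>a\<close>, so values
  on it can be prescribed. Thus a cyclic word that is not decomposable would be detected by a
  functional of the kind treated above.\<close>

lemma (in vector_space) separating_functional:
  assumes "subspace S" "a \<notin> S"
  obtains g where "\<And>x y. g (x + y) = g x + g y" "\<And>c x. g (scale c x) = c * g x"
    "\<And>x. x \<in> S \<Longrightarrow> g x = 0" "g a = 1"
proof -
  interpret field_space: vector_space "(*) :: 'a \<Rightarrow> 'a \<Rightarrow> 'a"
    by standard (simp_all add: algebra_simps)
  interpret pair: vector_space_pair scale "(*) :: 'a \<Rightarrow> 'a \<Rightarrow> 'a" ..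
  obtain B where B: "B \<subseteq> S" "independent B" "S \<subseteq> span B"
    using maximal_independent_subset by blast
  have span: "span B \<subseteq> S" using B(1) assms(1) by (rule span_minimal)
  then have ind: "independent (insert a B)"
    using B(2) assms(2) by (intro independent_insertI) auto
  obtain g where g: "Vector_Spaces.linear scale (*) g"
    "\<forall>x\<in>insert a B. g x = (if x = a then 1 else 0)"
    using pair.linear_independent_extend[OF ind, of "\<lambda>x. if x = a then 1 else 0"] by blast
  have "g x = 0" if "x \<in> S" for x
  proof (rule pair.linear_eq_0_on_span[OF g(1)])
    show "x \<in> span B" using that B(3) by blast
    show "g b = 0" if "b \<in> B" for b using that g(2) B(1) assms(2) by auto
  qed
  moreover have "g a = 1" using g(2) by simp
  moreover have "g (x + y) = g x + g y" "g (scale c x) = c * g x" for x y c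
    using g(1) by (simp_all add: Vector_Spaces.linear_iff)
  ultimately show ?thesis using that by blast
qed

lemma cyclic_der_append_commute: "cyclic_der (u @ v) = cyclic_der (v @ u)"
proof -
  have "substitute (rotate c w) z = substitute w z" for c and w z :: "'a letter list"
  proof -
    have rot: "rotate r (rotate c w) = rotate c (rotate r w)" for r
      by (simp add: rotate_rotate add.commute)
    show ?thesis
      unfolding substitute_def length_rotate rot
      by (rule sum.cong[OF refl], rule sum_rotate_shift)
  qed
  then have "cyclic_der (rotate (length u) (u @ v)) = cyclic_der (u @ v)"
    by (intro ext) (simp add: cyclic_der_def)
  then show ?thesis by (simp add: rotate_append)
qed

lemma rotate_Cons_append: "q < length w \<Longrightarrow> rotate q w = w ! q # drop (Suc q) w @ take q w"
  by (simp add: rotate_drop_take Cons_nth_drop_Suc[symmetric])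

text \<open>Quadratic words act as elements of the symplectic Lie algebra, in weight 0. They serve
  as elementary moves: one letter \<open>dual a\<close> becomes \<open>b\<close>, or one letter
  \<open>dual b\<close> becomes \<open>a\<close>.\<close>

lemma bracket_quadratic:
  fixes w :: "'n::finite letter list"
  assumes "2 \<le> length w"
  shows "bracket (cyclic_der [a, b]) (cyclic_der w) =
    - (\<Sum>q<length w. operator_scale (pairing a (w ! q)) (cyclic_der (w[q := b])))
    - (\<Sum>q<length w. operator_scale (pairing b (w ! q)) (cyclic_der (w[q := a])))"
proof -
  have upd: "cyclic_der ([c] @ drop (Suc q) w @ take q w) = cyclic_der (w[q := c])" if "q < length w" for q c
    using cyclic_der_append_commute[of "take q w" "[c] @ drop (Suc q) w"] that
    by (simp add: upd_conv_take_nth_drop)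
  have *: "(\<Sum>q<length w. operator_scale (pairing c (hd (rotate q w))) (cyclic_der ([d] @ tl (rotate q w))))
    = (\<Sum>q<length w. operator_scale (pairing c (w ! q)) (cyclic_der (w[q := d])))" for c d
    by (rule sum.cong) (use upd in \<open>auto simp: rotate_Cons_append\<close>)
  show ?thesis
    using assms *[of a b] *[of b a] by (simp add: bracket_cyclic_der numeral_2_eq_2)
qed

section \<open>Reduction to chord diagrams\<close>

text \<open>In a word without repetitions its cardinality is twice the number of chords; it is the
  measure of the induction on chords.\<close>

definition matched :: "'n letter list \<Rightarrow> 'n letter set" where
  "matched w = {x \<in> set w. dual x \<in> set w}"

lemma finite_matched [simp]: "finite (matched w)"
  by (simp add: matched_def)

definition rename :: "'n letter \<Rightarrow> 'n letter \<Rightarrow> 'n letter \<Rightarrow> 'n letter" where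
  "rename y t x = (if x = y then t else if x = dual y then dual t else x)"

lemma rename_dual: "rename y t (dual x) = dual (rename y t x)"
  by (auto simp: rename_def)

lemma inj_on_rename: "inj_on (rename y t) {x. x \<noteq> t \<and> x \<noteq> dual t}"
  by (auto simp: inj_on_def rename_def)

lemma
  assumes "t \<notin> set w" "dual t \<notin> set w"
  shows distinct_rename: "distinct w \<Longrightarrow> distinct (map (rename y t) w)"
    and card_matched_rename: "card (matched (map (rename y t) w)) = card (matched w)"
proof -
  let ?U = "{x. x \<noteq> t \<and> x \<noteq> dual t}"
  have sub: "set w \<subseteq> ?U" using assms by auto
  have inj: "inj_on (rename y t) (set w)"
    using inj_on_rename sub by (rule inj_on_subset)
  then show "distinct w \<Longrightarrow> distinct (map (rename y t) w)"
    by (simp add: distinct_map)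
  have "dual x \<in> set w" if x: "x \<in> set w" "dual (rename y t x) \<in> rename y t ` set w" for x
  proof -
    obtain z where z: "z \<in> set w" "rename y t (dual x) = rename y t z"
      using x(2) by (auto simp: rename_dual)
    moreover have "dual x \<in> ?U" using x(1) assms by auto
    ultimately show ?thesis using inj_onD[OF inj_on_rename z(2)] sub by auto
  qed
  then have "matched (map (rename y t) w) = rename y t ` matched w"
    by (auto simp: matched_def rename_dual[symmetric])
  moreover have "inj_on (rename y t) (matched w)"
    using inj by (rule inj_on_subset) (auto simp: matched_def)
  ultimately show "card (matched (map (rename y t) w)) = card (matched w)"
    by (simp add: card_image)
qed

text \<open>Pigeonhole on the indices of the letters. The bound on the genus is used through this
  lemma.\<close>

lemma fresh_index:
  fixes w :: "'n::finite letter list"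
  assumes "length w < CARD('n)"
  obtains i where "A i \<notin> set w" "B i \<notin> set w"
proof -
  let ?idx = "case_letter (\<lambda>i. i) (\<lambda>i. i)"
  have "card (?idx ` set w) < card (UNIV :: 'n set)"
    using assms card_image_le[of "set w" ?idx] card_length[of w] by simp
  then have "?idx ` set w \<noteq> UNIV" by auto
  then obtain i where i: "i \<notin> ?idx ` set w" by blast
  have "A i \<notin> set w" using i by (metis image_eqI letter.case(1))
  moreover have "B i \<notin> set w" using i by (metis image_eqI letter.case(2))
  ultimately show ?thesis using that by blast
qed

lemma sum_pairing_position:
  assumes "distinct w" "p < length w" "w ! p = dual a"
  shows "(\<Sum>q<length w. operator_scale (pairing a (w ! q)) (h q)) = operator_scale (sgn_letter a) (h p)"
proof -
  have "(\<Sum>q<length w. operator_scale (pairing a (w ! q)) (h q))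
      = (\<Sum>q<length w. if q = p then operator_scale (sgn_letter a) (h q) else 0)"
  proof (rule sum.cong[OF refl])
    fix q assume "q \<in> {..<length w}"
    then have "w ! q = dual a \<longleftrightarrow> q = p"
      using nth_eq_iff_index_eq[OF assms(1) _ assms(2), of q] assms(3) by simp
    then show "operator_scale (pairing a (w ! q)) (h q)
        = (if q = p then operator_scale (sgn_letter a) (h q) else 0)"
      by (simp add: pairing_def)
  qed
  then show ?thesis using assms(2) by (simp add: sum.delta)
qed

lemma quadratic_action_decomposable:
  fixes w :: "'n::finite letter list"
  assumes "2 \<le> length w" "cyclic_der w \<in> decomposables k"
  shows "(\<Sum>q<length w. operator_scale (pairing a (w ! q)) (cyclic_der (w[q := b])))
    + (\<Sum>q<length w. operator_scale (pairing b (w ! q)) (cyclic_der (w[q := a]))) \<in> decomposables k"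
    (is "?P + ?Q \<in> _")
proof -
  have "bracket (cyclic_der [a, b]) (cyclic_der w) \<in> decomposables k"
    using assms(2) by (intro decomposables_bracket_zero cyclic_der_weight) auto
  then have "- (- ?P - ?Q) \<in> decomposables k"
    unfolding bracket_quadratic[OF assms(1)]
    by (rule operator.subspace_neg[OF subspace_decomposables])
  then show ?thesis by (simp add: add.commute)
qed

section \<open>Relations for functionals that kill the decomposables\<close>

context
  fixes k n :: nat
  assumes n: "n = k + 2" "5 \<le> n" and genus: "n < CARD('n::finite)"
begin

text \<open>
  Replacing only one end \<open>y\<close> of a chord by \<open>t\<close> leaves fewer chords; the quadratic word
  \<open>[dual t, y]\<close> sends the result to a combination of \<open>w\<close> and its renaming.
\<close>

lemma rename_matched:
  fixes w :: "'n letter list" and g :: "('n tensor \<Rightarrow> 'n tensor) \<Rightarrow> rat"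
  assumes fewer: "\<And>w :: 'n letter list. distinct w \<Longrightarrow> length w = n \<Longrightarrow> card (matched w) < m \<Longrightarrow>
      cyclic_der w \<in> decomposables k"
    and g: "\<And>x y. g (x + y) = g x + g y" "\<And>c x. g (operator_scale c x) = c * g x"
      "\<And>x. x \<in> decomposables k \<Longrightarrow> g x = 0"
    and w: "distinct w" "length w = n" "card (matched w) = m"
    and y: "y \<in> set w" "dual y \<in> set w" and t: "t \<notin> set w" "dual t \<notin> set w"
  shows "g (cyclic_der (map (rename y t) w)) = sgn_letter y * sgn_letter t * g (cyclic_der w)"
proof -
  obtain p1 p2 where p: "p1 < n" "w ! p1 = y" "p2 < n" "w ! p2 = dual y"
    using y w(2) by (metis in_set_conv_nth)
  then have neq: "p1 \<noteq> p2" by auto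
  define u where "u = w[p1 := t]"
  have lu: "length u = n" by (simp add: u_def w)
  have u: "distinct u" "set u = insert t (set w - {y})"
    using w p t by (auto simp: u_def distinct_list_update set_update_distinct)
  \<comment> \<open>In \<open>u\<close> both \<open>t\<close> and \<open>dual y\<close> are legs, so
    one chord is lost.\<close>
  have "matched u \<subseteq> matched w - {y}"
    using t by (auto simp: matched_def u)
  then have "matched u \<subset> matched w"
    using y by (auto simp: matched_def)
  then have "card (matched u) < m"
    using w(3) psubset_card_mono[OF finite_matched] by blast
  then have "cyclic_der u \<in> decomposables k"
    using fewer u(1) lu by blast
  then have "(\<Sum>q<length u. operator_scale (pairing (dual t) (u ! q)) (cyclic_der (u[q := y])))
    + (\<Sum>q<length u. operator_scale (pairing y (u ! q)) (cyclic_der (u[q := dual t]))) \<in> decomposables k"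
    using n lu by (intro quadratic_action_decomposable) auto
  also have "(\<Sum>q<length u. operator_scale (pairing (dual t) (u ! q)) (cyclic_der (u[q := y])))
      = operator_scale (sgn_letter (dual t)) (cyclic_der (u[p1 := y]))"
    using u(1) lu p w(2) by (intro sum_pairing_position) (auto simp: u_def)
  also have "(\<Sum>q<length u. operator_scale (pairing y (u ! q)) (cyclic_der (u[q := dual t])))
      = operator_scale (sgn_letter y) (cyclic_der (u[p2 := dual t]))"
    using u(1) lu p neq by (intro sum_pairing_position) (auto simp: u_def)
  also have "u[p1 := y] = w"
    using p by (auto simp: u_def)
  also have "u[p2 := dual t] = map (rename y t) w"
  proof (rule nth_equalityI)
    fix q assume "q < length (u[p2 := dual t])"
    then have q: "q < n" by (simp add: lu)
    then show "u[p2 := dual t] ! q = map (rename y t) w ! q"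
      using p neq w nth_eq_iff_index_eq[OF w(1), of q p1] nth_eq_iff_index_eq[OF w(1), of q p2]
      by (auto simp: u_def rename_def nth_list_update)
  qed (simp add: lu w)
  finally have "g (operator_scale (sgn_letter (dual t)) (cyclic_der w)
      + operator_scale (sgn_letter y) (cyclic_der (map (rename y t) w))) = 0"
    by (rule g(3))
  then have "sgn_letter (dual t) * g (cyclic_der w)
      + sgn_letter y * g (cyclic_der (map (rename y t) w)) = 0"
    by (simp only: g(1,2))
  then have "sgn_letter y * g (cyclic_der (map (rename y t) w)) = sgn_letter t * g (cyclic_der w)"
    by simp
  then have "sgn_letter y * (sgn_letter y * g (cyclic_der (map (rename y t) w)))
      = sgn_letter y * (sgn_letter t * g (cyclic_der w))" by (rule arg_cong)
  then show ?thesis by simp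
qed

text \<open>Comes from the bracket of \<open>A i # u\<close> and \<open>B i # v\<close> for an index
  \<open>i\<close> outside \<open>u @ v\<close>. Both factors have positive weight because
  \<open>u\<close> and \<open>v\<close> have at least two letters.\<close>

lemma cut_relation:
  fixes g :: "('n tensor \<Rightarrow> 'n tensor) \<Rightarrow> rat"
  assumes g: "\<And>x y. g (x + y) = g x + g y" "\<And>c x. g (operator_scale c x) = c * g x"
      "\<And>x. x \<in> decomposables k \<Longrightarrow> g x = 0"
    and ren: "\<And>w y t. mset w = mset (u @ v) \<Longrightarrow> y \<in> set w \<Longrightarrow> dual y \<in> set w \<Longrightarrow> t \<notin> set w \<Longrightarrow>
      dual t \<notin> set w \<Longrightarrow>
      g (cyclic_der (map (rename y t) w)) = sgn_letter y * sgn_letter t * g (cyclic_der w)"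
    and uv: "distinct (u @ v)" "length (u @ v) = n" "2 \<le> length u" "2 \<le> length v"
  shows "g (cyclic_der (u @ v)) = (\<Sum>q<length v. resplice (\<lambda>w. g (cyclic_der w)) u v q)"
proof -
  obtain i where i: "A i \<notin> set (u @ v)" "B i \<notin> set (u @ v)"
    using fresh_index[of "u @ v"] uv(2) genus by metis
  let ?u = "A i # u" and ?v = "B i # v"
  let ?h = "\<lambda>p q. operator_scale (pairing (hd (rotate p ?u)) (hd (rotate q ?v)))
    (cyclic_der (tl (rotate p ?u) @ tl (rotate q ?v)))"
  let ?w = "\<lambda>x y p q. drop (Suc p) u @ x # take p u @ drop (Suc q) v @ y # take q v"
  have g_0: "g 0 = 0" using g(2)[of 0 0] by simp
  have g_sum: "g (sum h I) = (\<Sum>i\<in>I. g (h i))" for h and I :: "nat set"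
    by (induction I rule: infinite_finite_induct)
      (simp_all only: sum.infinite sum.empty sum.insert g_0 g(1) not_False_eq_True)
  have "bracket (cyclic_der ?u) (cyclic_der ?v) \<in> decomposables k"
    using uv n by (intro bracket_decomposable[of _ "length u - 1" _ "length v - 1"] cyclic_der_weight) auto
  moreover have "bracket (cyclic_der ?u) (cyclic_der ?v) = - (\<Sum>p<length ?u. \<Sum>q<length ?v. ?h p q)"
    using uv by (intro bracket_cyclic_der) auto
  ultimately have "- (- (\<Sum>p<length ?u. \<Sum>q<length ?v. ?h p q)) \<in> decomposables k"
    using operator.subspace_neg[OF subspace_decomposables] by metis
  then have "0 = g (\<Sum>p<length ?u. \<Sum>q<length ?v. ?h p q)"
    by (simp only: minus_minus g(3))
  also have "\<dots> = (\<Sum>p<length ?u. \<Sum>q<length ?v. g (?h p q))"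
    by (simp only: g_sum)
  \<comment> \<open>Contracting \<open>A i\<close> with \<open>B i\<close> gives
    \<open>u @ v\<close>. No other letter is dual to one of these two, so contractions involving
    just one of them vanish; the remaining ones give the terms of \<open>resplice\<close> after
    renaming the chord \<open>i\<close>.\<close>
  also have "\<dots> = g (?h 0 0) + (\<Sum>q<length v. g (?h 0 (Suc q)))
      + (\<Sum>p<length u. g (?h (Suc p) 0) + (\<Sum>q<length v. g (?h (Suc p) (Suc q))))"
    by (simp only: list.size add_Suc_right add_0_right sum.lessThan_Suc_shift)
  also have "g (?h 0 0) = g (cyclic_der (u @ v))"
    by (simp add: g(2) pairing_def)
  also have "(\<Sum>q<length v. g (?h 0 (Suc q))) = 0"
  proof (rule sum.neutral, rule ballI)
    fix q assume "q \<in> {..<length v}"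
    then have "hd (rotate (Suc q) ?v) = v ! q" by (subst rotate_Cons_append) auto
    moreover have "v ! q \<in> set v" using \<open>q \<in> _\<close> by simp
    then have "v ! q \<noteq> B i" using i by auto
    ultimately show "g (?h 0 (Suc q)) = 0"
      by (simp add: g_0 pairing_def)
  qed
  also have "(\<Sum>p<length u. g (?h (Suc p) 0) + (\<Sum>q<length v. g (?h (Suc p) (Suc q))))
      = (\<Sum>p<length u. \<Sum>q<length v. - (if u ! p = dual (v ! q)
          then g (cyclic_der (?w (v ! q) (dual (v ! q)) p q)) else 0))"
  proof (rule sum.cong[OF refl])
    fix p assume "p \<in> {..<length u}"
    then have p: "p < length u" by simp
    have rp: "rotate (Suc p) ?u = u ! p # drop (Suc p) u @ A i # take p u"
      using p by (subst rotate_Cons_append) auto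
    have "u ! p \<in> set u" using p by simp
    then have "u ! p \<noteq> A i" using i by auto
    then have "g (?h (Suc p) 0) = 0"
      unfolding rp by (cases "u ! p") (auto simp: g_0 pairing_def)
    moreover have "g (?h (Suc p) (Suc q)) = - (if u ! p = dual (v ! q)
          then g (cyclic_der (?w (v ! q) (dual (v ! q)) p q)) else 0)" if "q < length v" for q
    proof -
      have rq: "rotate (Suc q) ?v = v ! q # drop (Suc q) v @ B i # take q v"
        using that by (subst rotate_Cons_append) auto
      show ?thesis
      proof (cases "u ! p = dual (v ! q)")
        case False
        then have "pairing (u ! p) (v ! q) = 0" by (auto simp: pairing_def)
        then show ?thesis using False unfolding rp rq by (simp add: g_0)
      next
        case True
        let ?y = "v ! q"
        let ?t = "?w ?y (dual ?y) p q"
        have uv_split: "u = take p u @ u ! p # drop (Suc p) u" "v = take q v @ v ! q # drop (Suc q) v"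
          using p that by (simp_all add: id_take_nth_drop[symmetric])
        have "mset (u @ v) = mset (take p u @ u ! p # drop (Suc p) u) + mset (take q v @ v ! q # drop (Suc q) v)"
          using uv_split by simp
        then have mset: "mset ?t = mset (u @ v)"
          using True by simp
        then have t: "distinct ?t" "set ?t = set (u @ v)"
          using uv(1) by (metis mset_eq_imp_distinct_iff, metis mset_eq_setD)
        \<comment> \<open>The renaming contributes \<open>sgn_letter ?y\<close>, and the pairing of
          \<open>u ! p\<close> with \<open>?y\<close> is its negative, so the product of the two
          signs is always \<open>-1\<close>.\<close>
        have "g (cyclic_der (map (rename ?y (A i)) ?t)) = sgn_letter ?y * sgn_letter (A i) * g (cyclic_der ?t)"
          using i t(2) by (intro ren mset) auto
        also have "map (rename ?y (A i)) ?t = ?w (A i) (B i) p q"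
        proof -
          have idle: "map (rename ?y (A i)) x = x" if "?y \<notin> set x" "dual ?y \<notin> set x" for x
            using that by (intro map_idI) (auto simp: rename_def)
          have "map (rename ?y (A i)) (drop (Suc p) u) = drop (Suc p) u"
            "map (rename ?y (A i)) (take p u) = take p u"
            "map (rename ?y (A i)) (drop (Suc q) v) = drop (Suc q) v"
            "map (rename ?y (A i)) (take q v) = take q v"
            using t(1) by (intro idle; simp)+
          then show ?thesis by (simp add: rename_def)
        qed
        finally show ?thesis
          using True unfolding rp rq g(2) by (simp add: pairing_def)
      qed
    qed
    ultimately show "g (?h (Suc p) 0) + (\<Sum>q<length v. g (?h (Suc p) (Suc q)))
        = (\<Sum>q<length v. - (if u ! p = dual (v ! q)
          then g (cyclic_der (?w (v ! q) (dual (v ! q)) p q)) else 0))"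
      by simp
  qed
  also have "\<dots> = - (\<Sum>q<length v. resplice (\<lambda>w. g (cyclic_der w)) u v q)"
    unfolding resplice_def by (subst sum.swap) (simp add: sum_negf)
  finally show ?thesis by simp
qed

text \<open>The induction hypothesis settles diagrams with fewer chords, which is what
  \<open>rename_matched\<close> asks for. A functional that kills the decomposables and is
  \<open>1\<close> at \<open>w\<close> would then contradict \<open>vanish\<close>.\<close>

lemma cyclic_der_decomposable_distinct:
  fixes w :: "'n letter list"
  assumes "distinct w" "length w = n"
  shows "cyclic_der w \<in> decomposables k"
  using assms
proof (induction "card (matched w)" arbitrary: w rule: less_induct)
  case less
  show ?case
  proof (rule ccontr)
    assume "cyclic_der w \<notin> decomposables k"
    then obtain g where g: "\<And>x y. g (x + y) = g x + g y" "\<And>c x. g (operator_scale c x) = c * g x"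
      "\<And>x. x \<in> decomposables k \<Longrightarrow> g x = 0" "g (cyclic_der w) = 1"
      using operator.separating_functional[OF subspace_decomposables] by metis
    have ren: "g (cyclic_der (map (rename y t) z)) = sgn_letter y * sgn_letter t * g (cyclic_der z)"
      if "distinct z" "length z = n" "card (matched z) = card (matched w)" "y \<in> set z" "dual y \<in> set z"
        "t \<notin> set z" "dual t \<notin> set z" for z y t
      by (rule rename_matched[OF less.hyps g(1,2,3) that])
    have same: "length z = n" "card (matched z) = card (matched w)" if "distinct z" "set z = set w" for z
      using that less.prems by (auto simp: matched_def distinct_card[symmetric])
    interpret necklace_functional "\<lambda>w. g (cyclic_der w)" "set w"
    proof
      show "finite (set w)" by simp
      show "5 \<le> card (set w)" using less.prems n by (simp add: distinct_card)
      show "g (cyclic_der (u @ v)) = g (cyclic_der (v @ u))" for u v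
        by (simp add: cyclic_der_append_commute)
    next
      fix z :: "'n letter list" and y p
      assume z: "distinct z" "set z = set w" and yp: "{y, dual y, p, dual p} \<subseteq> set w" "p \<noteq> y" "p \<noteq> dual y"
      obtain i where i: "A i \<notin> set z" "B i \<notin> set z"
        using fresh_index[of z] same[OF z] genus by metis
      let ?t = "A i"
      define z1 where "z1 = map (rename p ?t) z"
      define z2 where "z2 = map (rename y p) z1"
      have t: "?t \<notin> set z" "dual ?t \<notin> set z" using i by simp_all
      have mem: "y \<in> set z" "dual y \<in> set z" "p \<in> set z" "dual p \<in> set z"
        using yp z(2) by auto
      have "dual y \<noteq> p" "dual y \<noteq> dual p" "y \<noteq> dual p"
        using yp(2,3) dual_dual[of y] dual_dual[of p] by (auto simp del: dual_dual)
      note neq = this yp(2,3)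
      have z1: "distinct z1" "length z1 = n" "card (matched z1) = card (matched w)"
        unfolding z1_def using distinct_rename[OF t] card_matched_rename[OF t] same[OF z] z by simp_all
      have p_z1: "p \<notin> set z1" "dual p \<notin> set z1"
        using t mem by (auto simp: z1_def rename_def split: if_splits)
      have y_z1: "y \<in> set z1" "dual y \<in> set z1"
        using mem neq by (auto simp: z1_def rename_def image_iff intro!: bexI[of _ y] bexI[of _ "dual y"])
      have t_z1: "?t \<in> set z1" "dual ?t \<in> set z1"
        using mem by (auto simp: z1_def rename_def image_iff intro!: bexI[of _ p] bexI[of _ "dual p"])
      have z2: "distinct z2" "length z2 = n" "card (matched z2) = card (matched w)"
        unfolding z2_def using distinct_rename[OF p_z1] card_matched_rename[OF p_z1] z1 by simp_all
      have y_z2: "dual y \<notin> set z2" "dual (dual y) \<notin> set z2"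
        using p_z1 y_z1 neq by (auto simp: z2_def rename_def split: if_splits)
      have t_y: "?t \<noteq> y" "?t \<noteq> dual y" "dual ?t \<noteq> y" "dual ?t \<noteq> dual y"
        using t mem by auto
      have t_p: "?t \<noteq> p" "?t \<noteq> dual p" "dual ?t \<noteq> p" "dual ?t \<noteq> dual p"
        using t mem by auto
      have t_z2: "?t \<in> set z2" "dual ?t \<in> set z2"
        using t_z1 t_y by (auto simp: z2_def rename_def image_iff intro!: bexI[of _ ?t] bexI[of _ "dual ?t"])
      have "map (exchange y p) z = map (rename ?t (dual y)) z2"
        unfolding z1_def z2_def map_map
        by (rule map_cong[OF refl]) (use t neq t_y t_p in \<open>auto simp: exchange_def rename_def\<close>)
      then have "g (cyclic_der (map (exchange y p) z))
          = sgn_letter ?t * sgn_letter (dual y) * g (cyclic_der z2)"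
        using ren[OF z2 t_z2 y_z2] by simp
      also have "\<dots> = sgn_letter ?t * sgn_letter (dual y) * (sgn_letter y * sgn_letter p *
          (sgn_letter p * sgn_letter ?t * g (cyclic_der z)))"
        using ren[OF z1 y_z1 p_z1] ren[OF z(1) same[OF z] mem(3,4) t]
        by (simp add: z1_def[symmetric] z2_def[symmetric])
      also have "\<dots> = - g (cyclic_der z)"
        by (cases y; cases p) auto
      finally show "g (cyclic_der (map (exchange y p) z)) = - g (cyclic_der z)" .
    next
      fix u v :: "'n letter list"
      assume uv: "distinct (u @ v)" "set (u @ v) = set w" "2 \<le> length u" "2 \<le> length v"
      show "g (cyclic_der (u @ v)) = (\<Sum>q<length v. resplice (\<lambda>w. g (cyclic_der w)) u v q)"
      proof (rule cut_relation[OF g(1,2,3)])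
        fix z :: "'n letter list" and y t
        assume z: "mset z = mset (u @ v)" and "y \<in> set z" "dual y \<in> set z" "t \<notin> set z" "dual t \<notin> set z"
        moreover have "distinct z" "set z = set w"
          using uv z by (metis mset_eq_imp_distinct_iff, metis mset_eq_setD)
        ultimately show "g (cyclic_der (map (rename y t) z)) = sgn_letter y * sgn_letter t * g (cyclic_der z)"
          using ren same by blast
      qed (use uv same in blast)+
    qed
    have "g (cyclic_der w) = 0"
      using less.prems by (intro vanish) (simp add: adm_iff)
    then show False using g(4) by simp
  qed
qed

text \<open>Induction on the number of repetitions. Replacing one copy of a repeated letter
  \<open>x\<close> by a fresh \<open>t\<close> gives a word with more distinct letters, and the
  quadratic word \<open>[dual t, x]\<close> turns \<open>t\<close> back into
  \<open>x\<close>.\<close>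

lemma cyclic_der_decomposable:
  fixes w :: "'n letter list"
  assumes "length w = n"
  shows "cyclic_der w \<in> decomposables k"
  using assms
proof (induction "n - card (set w)" arbitrary: w rule: less_induct)
  case less
  show ?case
  proof (cases "distinct w")
    case True
    then show ?thesis using cyclic_der_decomposable_distinct less.prems by blast
  next
    case False
    then obtain us vs ys x where "w = us @ [x] @ vs @ [x] @ ys"
      using not_distinct_decomp by blast
    then obtain u v where w: "w = u @ x # v" "x \<in> set (u @ v)"
      by (metis Un_iff append_Cons append_Nil in_set_conv_decomp set_append)
    obtain i where i: "A i \<notin> set w" "B i \<notin> set w"
      using fresh_index[of w] less.prems genus by metis
    define t where "t = A i"
    have t: "t \<notin> set w" "dual t \<notin> set w" using i by (simp_all add: t_def)
    define w' where "w' = u @ t # v"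
    have lw': "length w' = n" using less.prems by (simp add: w'_def w)
    have set_w': "set w' = insert t (set w)" using w by (auto simp: w'_def)
    have card_w: "card (set w) < n"
      using False less.prems card_distinct[of w] card_length[of w] by (metis le_neq_implies_less)
    have IH: "cyclic_der z \<in> decomposables k" if "length z = n" "card (set w) < card (set z)" for z :: "'n letter list"
      using less.hyps[of z] that card_w by simp
    have "cyclic_der w' \<in> decomposables k"
      using t lw' by (intro IH) (auto simp: set_w')
    then have "(\<Sum>q<length w'. operator_scale (pairing (dual t) (w' ! q)) (cyclic_der (w'[q := x])))
      + (\<Sum>q<length w'. operator_scale (pairing x (w' ! q)) (cyclic_der (w'[q := dual t])))
        \<in> decomposables k" (is "?P + ?Q \<in> _")
      using n lw' by (intro quadratic_action_decomposable) auto
    \<comment> \<open>The other half of the action replaces a \<open>dual x\<close> by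
      \<open>dual t\<close>. Compared with \<open>w\<close>, at most the letter
      \<open>dual x\<close> is lost while \<open>t\<close> and \<open>dual t\<close> are gained, so
      the induction hypothesis applies.\<close>
    moreover have "?Q \<in> decomposables k"
    proof (intro operator.subspace_sum subspace_decomposables)
      fix q assume "q \<in> {..<length w'}"
      then have q: "q < length w'" by simp
      show "operator_scale (pairing x (w' ! q)) (cyclic_der (w'[q := dual t])) \<in> decomposables k"
      proof (cases "w' ! q = dual x")
        case False
        then show ?thesis
          using operator.subspace_0[OF subspace_decomposables] by (simp add: pairing_def)
      next
        case True
        then have "dual x \<in> set w'" using q by (metis nth_mem)
        moreover have "dual x \<noteq> t" using t w(1) by auto
        ultimately have x: "dual x \<in> set w" using set_w' by simp
        have "(set w' - {dual x}) \<union> {dual t} \<subseteq> set (w'[q := dual t])"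
        proof -
          have "z \<in> set (w'[q := dual t])" if "z \<in> set w'" "z \<noteq> dual x" for z
          proof -
            obtain r where "r < length w'" "w' ! r = z" using \<open>z \<in> set w'\<close> by (metis in_set_conv_nth)
            moreover from this have "r \<noteq> q" using True that(2) by auto
            ultimately show ?thesis by (metis length_list_update nth_list_update_neq nth_mem)
          qed
          moreover have "dual t \<in> set (w'[q := dual t])" using q by (rule set_update_memI)
          ultimately show ?thesis by blast
        qed
        then have "card ((set w' - {dual x}) \<union> {dual t}) \<le> card (set (w'[q := dual t]))"
          by (intro card_mono) auto
        moreover have "card ((set w' - {dual x}) \<union> {dual t}) = Suc (card (set w))"
        proof -
          have "card (set w' - {dual x}) = card (set w)"
            using t x by (subst card_Diff_singleton) (auto simp: set_w')
          moreover have "dual t \<notin> set w' - {dual x}" using t by (auto simp: set_w')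
          ultimately show ?thesis by simp
        qed
        ultimately have "cyclic_der (w'[q := dual t]) \<in> decomposables k"
          using lw' by (intro IH) auto
        then show ?thesis by (rule operator.subspace_scale[OF subspace_decomposables])
      qed
    qed
    ultimately have "(?P + ?Q) - ?Q \<in> decomposables k"
      by (rule operator.subspace_diff[OF subspace_decomposables])
    also have "(?P + ?Q) - ?Q = ?P" by simp
    also have "?P = operator_scale (- sgn_letter t) (cyclic_der w)"
    proof -
      have *: "w' ! q = t \<longleftrightarrow> q = length u" if "q < length w'" for q
      proof -
        have "q < length u \<Longrightarrow> u ! q \<noteq> t" "length u < q \<Longrightarrow> v ! (q - Suc (length u)) \<noteq> t"
          using t w(1) that nth_mem[of q u] nth_mem[of "q - Suc (length u)" v]
          by (auto simp: w'_def)
        then show ?thesis by (auto simp: w'_def nth_append nth_Cons' split: if_splits)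
      qed
      have "?P = (\<Sum>q<length w'. if q = length u then operator_scale (- sgn_letter t) (cyclic_der w) else 0)"
        by (rule sum.cong) (auto simp: pairing_def *, simp_all add: w'_def w(1))
      then show ?thesis by (simp add: sum.delta w'_def)
    qed
    \<comment> \<open>The scalar \<open>- sgn_letter t\<close> is its own inverse.\<close>
    finally have "operator_scale (- sgn_letter t) (operator_scale (- sgn_letter t) (cyclic_der w)) \<in> decomposables k"
      by (rule operator.subspace_scale[OF subspace_decomposables])
    then show ?thesis by (simp del: operator.scale_minus_left)
  qed
qed

end

section \<open>The weight \<open>k\<close> part of the abelianization\<close>

theorem theorem5p1:
  fixes g k :: nat
  assumes "CARD('n::finite) = g"
    and "g \<ge> k + 3" and "k + 3 \<ge> 6"
  shows "(H1_weight k :: ('n tensor \<Rightarrow> 'n tensor) set set) = {decomposables k} \<and>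
    (sympl_der_weight k :: ('n tensor \<Rightarrow> 'n tensor) set) =
      (\<Sum>(i, j) \<in> {(i, j). i + j = k \<and> 1 \<le> i \<and> 1 \<le> j}.
        brackets (sympl_der_weight i) (sympl_der_weight j))"
proof -
  let ?W = "sympl_der_weight k :: ('n tensor \<Rightarrow> 'n tensor) set"
  have "cyclic_der w \<in> decomposables k" if "length w = k + 2" for w :: "'n letter list"
    using assms that by (intro cyclic_der_decomposable[of "k + 2"]) auto
  then have "operator.span {cyclic_der w | w :: 'n letter list. length w = k + 2} \<subseteq> decomposables k"
    by (intro operator.span_minimal subspace_decomposables) auto
  then have eq: "?W = decomposables k"
    using sympl_der_weight_span decomposables_weight by blast
  \<comment> \<open>All elements of weight \<open>k\<close> are equivalent, so the quotient consists
    of the single coset \<open>?W\<close>.\<close>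
  have "D - E \<in> decomposables k" if "D \<in> ?W" "E \<in> ?W" for D E
    using that operator.subspace_diff[OF subspace_decomposables] unfolding eq by blast
  then have "{(D, E). D \<in> ?W \<and> E \<in> ?W \<and> D - E \<in> decomposables k} = ?W \<times> ?W"
    by blast
  moreover have "?W \<noteq> {}"
    using operator.subspace_0[OF subspace_decomposables] unfolding eq by blast
  ultimately have "H1_weight k = {?W}"
    unfolding H1_weight_def by (auto simp: quotient_def)
  then show ?thesis using eq by (simp add: decomposables_def)
qed

end
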